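(* Let $n\ge2$, let $\rho=\{r_1,\ldots,r_n\}$ with $0<r_1<\cdots<r_n<\infty$, and let $h:=\max_{1\le j\le n-1}(r_{j+1}-r_j)$. Let $f\in\Lambda_0$, and let $\sigma$ be one of the following two interpolants to $f$: $\sigma^A$, the unique element of $\mathcal{S}_0(\rho)$ with $\sigma^A(r_j)=f(r_j)$ for $1\le j\le n$ and $\sigma^A(0)=f(0)$; or $\sigma^B$, the unique non-singular element of $\mathcal{S}_0(\rho)$ with $\sigma^B(r_j)=f(r_j)$ for $1\le j\le n$. If $p\in[2,\infty]$ and $l\in\{0,1\}$, then $$\left\|f^{(l)}-\sigma^{(l)}\right\|_{L^p[r_1,r_n]}\le\frac{1}{2^{1-l}\sqrt{r_1}}\,h^{3/2+1/p-l}\,\|f\|_0 ,$$ where $1/p:=0$ if $p=\infty$.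
   Context: $\Lambda_0$ is the space of complex-valued $f\in C^1(0,\infty)$ such that $f'$ is absolutely continuous on every compact interval $[a,b]$ with $0<a<b<\infty$ and $$\|f\|_0^2:=\int_0^\infty\left(r|f''(r)|^2+\frac1r|f'(r)|^2\right)dr<\infty.$$ Every $f\in\Lambda_0$ extends continuously to $r=0$, and $f(0)$ denotes the value of this extension. Define the differential operators $$L_0=r\frac{d^4}{dr^4}+2\frac{d^3}{dr^3}-\frac1r\frac{d^2}{dr^2}+\frac1{r^2}\frac{d}{dr},\quad G_0=\frac{d^3}{dr^3}-\frac1r\frac{d^2}{dr^2}+\frac1{r^2}\frac{d}{dr},\quad R_0=\frac1r\left[\frac{d^2}{dr^2}+\frac1r\frac{d}{dr}\right].$$ On any open subinterval of $(0,\infty)$ their null spaces are $\mathrm{Ker}\,L_0=\mathrm{span}\{r^2,r^2\ln r,1,\ln r\}$, $\mathrm{Ker}\,G_0=\mathrm{span}\{r^2,r^2\ln r,1\}$, $\mathrm{Ker}\,R_0=\mathrm{span}\{1,\ln r\}$. For knots $\rho=\{r_1<\cdots<r_n\}\subset(0,\infty)$, a function $\eta:[0,\infty)\to\mathbb{C}$, continuous at $0$, is called a Beppo Levi $L_0$-spline on $\rho$ if: (i) $L_0\eta(r)=0$ for all $r\in(r_j,r_{j+1})$ and all $j\in\{1,\ldots,n-1\}$; (ii) $G_0\eta(r)=0$ for all $r\in(0,r_1)$ and $R_0\eta(r)=0$ for all $r>r_n$; (iii) $\eta$ is $C^2$-continuous at each knot $r_1,\ldots,r_n$. The set of all such functions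 is $\mathcal{S}_0(\rho)\subset\Lambda_0$. A spline $\eta\in\mathcal{S}_0(\rho)$ is called non-singular if its restriction to $(0,r_1)$ belongs to $\mathrm{span}\{r^2,1\}$. The interpolants $\sigma^A$ and $\sigma^B$ described in the claim exist and are unique. *)

theory Defs
  imports "HOL-Analysis.Analysis" "HOL-Probability.Essential_Supremum"
begin

text \<open>Only meaningful where \<open>f\<close> is \<open>k\<close> times differentiable (\<open>vector_derivative\<close> is
  unspecified elsewhere); differentiability is always demanded separately below.\<close>

definition nth_deriv :: "nat \<Rightarrow> (real \<Rightarrow> complex) \<Rightarrow> real \<Rightarrow> complex" where
  "nth_deriv k = (\<lambda>g r. vector_derivative g (at r)) ^^ k"

definition times_differentiable_on :: "nat \<Rightarrow> (real \<Rightarrow> complex) \<Rightarrow> real set \<Rightarrow> bool" where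
  "times_differentiable_on m f S \<longleftrightarrow> (\<forall>k<m. \<forall>r\<in>S. nth_deriv k f differentiable (at r))"

text \<open>The usual \<open>\<epsilon>\<close>-\<open>\<delta>\<close> notion: \<open>D\<close> ranges over the finite families of non-overlapping compact
  subintervals \<open>K = {Inf K..Sup K}\<close> of \<open>{a..b}\<close>.\<close>

definition absolutely_continuous_on_interval :: "(real \<Rightarrow> complex) \<Rightarrow> real \<Rightarrow> real \<Rightarrow> bool" where
  "absolutely_continuous_on_interval g a b \<longleftrightarrow>
     (\<forall>\<epsilon>>0. \<exists>\<delta>>0. \<forall>D. D division_of \<Union>D \<and> \<Union>D \<subseteq> {a..b} \<and> (\<Sum>K\<in>D. Sup K - Inf K) < \<delta>
        \<longrightarrow> (\<Sum>K\<in>D. norm (g (Sup K) - g (Inf K))) < \<epsilon>)"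

text \<open>The second derivative below exists only almost everywhere. Integration is with respect to the
  complete measure \<open>lebesgue\<close>, so that its values on the exceptional null set do not matter.\<close>

definition energy_density :: "(real \<Rightarrow> complex) \<Rightarrow> real \<Rightarrow> real" where
  "energy_density f r = r * (norm (nth_deriv 2 f r))\<^sup>2 + 1 / r * (norm (nth_deriv 1 f r))\<^sup>2"

definition norm0 :: "(real \<Rightarrow> complex) \<Rightarrow> real" where
  "norm0 f = sqrt (LINT r:{0<..}|lebesgue. energy_density f r)"

definition Lambda0 :: "(real \<Rightarrow> complex) set" where
  "Lambda0 = {f. f C1_differentiable_on {0<..}
     \<and> (\<forall>a b. 0 < a \<and> a < b \<longrightarrow> absolutely_continuous_on_interval (nth_deriv 1 f) a b)
     \<and> set_integrable lebesgue {0<..} (energy_density f)}"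

text \<open>Members of \<^const>\<open>Lambda0\<close> are functions on the open half-line, so their value at 0 is the
  value of the continuous extension and not \<open>f 0\<close>.\<close>

definition value_at_0 :: "(real \<Rightarrow> complex) \<Rightarrow> complex" where
  "value_at_0 f = Lim (at_right 0) f"

definition op_L0 :: "(real \<Rightarrow> complex) \<Rightarrow> real \<Rightarrow> complex" where
  "op_L0 f r = of_real r * nth_deriv 4 f r + 2 * nth_deriv 3 f r
     - of_real (1 / r) * nth_deriv 2 f r + of_real (1 / r\<^sup>2) * nth_deriv 1 f r"

definition op_G0 :: "(real \<Rightarrow> complex) \<Rightarrow> real \<Rightarrow> complex" where
  "op_G0 f r = nth_deriv 3 f r - of_real (1 / r) * nth_deriv 2 f r
     + of_real (1 / r\<^sup>2) * nth_deriv 1 f r"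

definition op_R0 :: "(real \<Rightarrow> complex) \<Rightarrow> real \<Rightarrow> complex" where
  "op_R0 f r = of_real (1 / r) * (nth_deriv 2 f r + of_real (1 / r) * nth_deriv 1 f r)"

definition C2_at :: "(real \<Rightarrow> complex) \<Rightarrow> real \<Rightarrow> bool" where
  "C2_at f t \<longleftrightarrow> (\<exists>U. open U \<and> t \<in> U \<and> times_differentiable_on 2 f U) \<and> isCont (nth_deriv 2 f) t"

text \<open>The knots are \<open>\<rho> 1 < \<dots> < \<rho> n\<close>. A function on the closed half-line is represented by
  any \<open>\<eta> :: real \<Rightarrow> complex\<close>; its values at negative arguments are irrelevant.\<close>

definition knots :: "nat \<Rightarrow> (nat \<Rightarrow> real) \<Rightarrow> bool" where
  "knots n \<rho> \<longleftrightarrow> 0 < \<rho> 1 \<and> strict_mono_on {1..n} \<rho>"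

definition mesh :: "nat \<Rightarrow> (nat \<Rightarrow> real) \<Rightarrow> real" where
  "mesh n \<rho> = Max ((\<lambda>j. \<rho> (Suc j) - \<rho> j) ` {1..n - 1})"

definition S0 :: "nat \<Rightarrow> (nat \<Rightarrow> real) \<Rightarrow> (real \<Rightarrow> complex) set" where
  "S0 n \<rho> = {\<eta>. continuous (at 0 within {0..}) \<eta>
     \<and> (\<forall>j\<in>{1..n - 1}. times_differentiable_on 4 \<eta> {\<rho> j<..<\<rho> (Suc j)}
           \<and> (\<forall>r\<in>{\<rho> j<..<\<rho> (Suc j)}. op_L0 \<eta> r = 0))
     \<and> times_differentiable_on 3 \<eta> {0<..<\<rho> 1} \<and> (\<forall>r\<in>{0<..<\<rho> 1}. op_G0 \<eta> r = 0)
     \<and> times_differentiable_on 2 \<eta> {\<rho> n<..} \<and> (\<forall>r\<in>{\<rho> n<..}. op_R0 \<eta> r = 0)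
     \<and> (\<forall>j\<in>{1..n}. C2_at \<eta> (\<rho> j))}"

definition non_singular :: "(nat \<Rightarrow> real) \<Rightarrow> (real \<Rightarrow> complex) \<Rightarrow> bool" where
  "non_singular \<rho> \<eta> \<longleftrightarrow> (\<exists>a b. \<forall>r\<in>{0<..<\<rho> 1}. \<eta> r = a * of_real (r\<^sup>2) + b)"

definition interpolant_A ::
    "nat \<Rightarrow> (nat \<Rightarrow> real) \<Rightarrow> (real \<Rightarrow> complex) \<Rightarrow> (real \<Rightarrow> complex) \<Rightarrow> bool" where
  "interpolant_A n \<rho> f \<sigma> \<longleftrightarrow>
     \<sigma> \<in> S0 n \<rho> \<and> (\<forall>j\<in>{1..n}. \<sigma> (\<rho> j) = f (\<rho> j)) \<and> \<sigma> 0 = value_at_0 f"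

definition interpolant_B ::
    "nat \<Rightarrow> (nat \<Rightarrow> real) \<Rightarrow> (real \<Rightarrow> complex) \<Rightarrow> (real \<Rightarrow> complex) \<Rightarrow> bool" where
  "interpolant_B n \<rho> f \<sigma> \<longleftrightarrow>
     \<sigma> \<in> S0 n \<rho> \<and> non_singular \<rho> \<sigma> \<and> (\<forall>j\<in>{1..n}. \<sigma> (\<rho> j) = f (\<rho> j))"

text \<open>Extended-valued, so that an upper bound also asserts membership in the Lebesgue space.
  The case distinction on \<open>I\<close> is the power \<open>I\<close> to the \<open>1/p\<close> on \<^typ>\<open>ennreal\<close>.\<close>

definition Lp_norm :: "ennreal \<Rightarrow> real set \<Rightarrow> (real \<Rightarrow> complex) \<Rightarrow> ennreal" where
  "Lp_norm p S g =
     (if p = \<infinity> then esssup (lebesgue_on S) (\<lambda>x. ennreal (norm (g x)))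
      else let I = (\<integral>\<^sup>+x. ennreal (norm (g x) powr enn2real p) \<partial>lebesgue_on S)
           in if I = \<infinity> then \<infinity> else ennreal (enn2real I powr (1 / enn2real p)))"

end

theory Submission
  imports Defs
begin

text \<open>
  Write \<open>g = f - \<sigma>\<close>. The estimate rests on one energy inequality: the weighted energies
  \<open>E\<^sub>j\<close>, each the integral of \<open>r \<bar>g''\<bar>\<^sup>2\<close> over \<open>[\<rho> j, \<rho> (j + 1)]\<close>, add up to at most
  \<open>\<parallel>f\<parallel>\<^sub>0\<^sup>2\<close> (\<open>interpolant_energy\<close>). This is the orthogonality of \<open>g\<close> to the spline, in the
  following form. On each piece the differential equation of \<open>\<sigma>\<close> integrates once to
  \<open>(r \<sigma>'')' = \<sigma>' / r - c\<close> with a constant \<open>c\<close> (\<open>flux_law\<close>), so the mixed energy density of \<open>g\<close>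
  and \<open>\<sigma>\<close> is the derivative of \<open>r \<sigma>'' \<bullet> g' + c \<bullet> g\<close>. Since \<open>g\<close> vanishes at the knots, the
  \<open>c\<close>-terms drop out there, and since \<open>r \<sigma>''\<close> is continuous the remaining terms telescope. What is
  left are contributions at \<open>a \<rightarrow> 0\<close> and \<open>b \<rightarrow> \<infinity>\<close>. Both \<open>\<sigma>'\<close> and \<open>r \<sigma>''\<close> tend to 0 there,
  and \<open>f'\<close> is small at suitable points, because \<open>\<bar>f'\<bar>\<^sup>2 / r\<close> is integrable and \<open>1 / r\<close> is not. On the first piece
  \<open>c \<bullet> g(a)\<close> disappears either because \<open>g(0) = 0\<close> or because a non-singular spline has \<open>c = 0\<close>:
  this is where the two interpolants differ.

  Given the energy inequality, Rolle's theorem for the real and imaginary parts of \<open>g\<close>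
  and the Cauchy-Schwarz inequality bound \<open>g'\<close> on the piece \<open>j\<close> by \<open>sqrt (h E\<^sub>j / r\<^sub>1)\<close>, and \<open>g\<close> by
  \<open>h / 2\<close> times that. Summing the integrals of \<open>p\<close>-th powers over the pieces uses that the powers
  \<open>E\<^sub>j powr (p / 2)\<close> add up to at most \<open>(\<Sum>j. E\<^sub>j) powr (p / 2)\<close>, which requires \<open>p \<ge> 2\<close>.

  The functions of \<open>\<Lambda>\<^sub>0\<close> have only an absolutely continuous derivative, so all this needs
  Lebesgue's theory: an absolutely continuous function is differentiable almost everywhere
  (\<open>abs_cont_has_vector_derivative_ae\<close>) and is the integral of its derivative
  (\<open>abs_cont_fundamental_theorem\<close>). Differentiability is obtained by Austin's geometric argument: if the
  difference quotients oscillate on a set of positive measure, then inserting Vitali intervals of the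
  wrong slope into a partition of nearly maximal variation pushes the variation above its supremum.
\<close>

section \<open>Functions of bounded variation are differentiable almost everywhere\<close>

text \<open>The value on \<open>{}\<close> is fixed to 0 so that increments over the intersections \<open>K \<inter> L\<close> of two
  divisions can be summed without excluding the empty ones.\<close>

definition increment :: "(real \<Rightarrow> 'a::real_normed_vector) \<Rightarrow> real set \<Rightarrow> 'a" where
  "increment F K = (if K = {} then 0 else F (Sup K) - F (Inf K))"

lemma increment_interval: "u \<le> v \<Longrightarrow> increment F {u..v} = F v - F u"
  by (simp add: increment_def)

lemma increment_degenerate: "v \<le> u \<Longrightarrow> increment F {u..v} = 0"
  by (cases "u = v") (auto simp: increment_def)

lemma sum_increment_division:
  assumes "q division_of {a..b}"
  shows "(\<Sum>K\<in>q. increment F K) = increment F {a..b}"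
proof -
  interpret operative_real plus 0 "increment F"
    rewrites "comm_monoid_set.F (+) 0 = sum"
    by standard[1] (auto simp add: sum_def increment_degenerate increment_interval)
  show ?thesis using division[of q a b] assms by simp
qed

lemma division_of_interval_memE:
  fixes D :: "real set set"
  assumes "D division_of S" "K \<in> D"
  obtains u v where "u \<le> v" "K = {u..v}" "K \<subseteq> S"
  using division_ofD[OF assms(1)] assms(2) by (metis atLeastatMost_empty_iff box_real(2) linorder_not_le)

text \<open>Two pairs of cells can have the same intersection, but then it lies in two non-overlapping
  intervals and is degenerate, so it contributes nothing to either side.\<close>

lemma sum_division_inter:
  fixes D q :: "real set set" and h :: "real set \<Rightarrow> 'a::comm_monoid_add"
  assumes D: "D division_of S" and q: "q division_of T"
    and h: "\<And>u v. v \<le> u \<Longrightarrow> h {u..v} = 0"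
  shows "(\<Sum>M\<in>{K \<inter> L | K L. K \<in> D \<and> L \<in> q \<and> K \<inter> L \<noteq> {}}. h M)
    = (\<Sum>K\<in>D. \<Sum>L\<in>q. h (K \<inter> L))"
proof -
  have fin: "finite (D \<times> q)"
    using D q by (simp add: division_of_finite)
  have h0: "h M = 0" if "M = {u..v}" "interior M = {}" for M u v
    using that h[of v u] by auto
  have int: "\<exists>u v. K \<inter> L = {u..v}" if KL: "K \<in> D" "L \<in> q" for K L
  proof -
    obtain u v where K: "K = {u..v}" using division_of_interval_memE[OF D KL(1)] .
    obtain u' v' where L: "L = {u'..v'}" using division_of_interval_memE[OF q KL(2)] .
    show ?thesis unfolding K L by (auto simp: Int_atLeastAtMost)
  qed
  have "(\<Sum>M\<in>{K \<inter> L | K L. K \<in> D \<and> L \<in> q \<and> K \<inter> L \<noteq> {}}. h M)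
      = (\<Sum>M\<in>(\<lambda>(K, L). K \<inter> L) ` (D \<times> q). h M)"
  proof (rule sum.mono_neutral_left)
    show "\<forall>i\<in>(\<lambda>(K, L). K \<inter> L) ` (D \<times> q) - {K \<inter> L |K L. K \<in> D \<and> L \<in> q \<and> K \<inter> L \<noteq> {}}. h i = 0"
    proof
      fix M assume "M \<in> (\<lambda>(K, L). K \<inter> L) ` (D \<times> q) - {K \<inter> L |K L. K \<in> D \<and> L \<in> q \<and> K \<inter> L \<noteq> {}}"
      then have "M = {}" by auto
      then show "h M = 0" using h[of 0 1] by simp
    qed
  qed (use fin in auto)
  also have "\<dots> = (\<Sum>x\<in>D \<times> q. h ((\<lambda>(K, L). K \<inter> L) x))"
  proof (rule sum.reindex_nontrivial[OF fin, unfolded o_def])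
    fix x y assume xy: "x \<in> D \<times> q" "y \<in> D \<times> q" "x \<noteq> y"
      "(case x of (K, L) \<Rightarrow> K \<inter> L) = (case y of (K, L) \<Rightarrow> K \<inter> L)"
    obtain K L K' L' where [simp]: "x = (K, L)" "y = (K', L')" by (cases x, cases y)
    have eq: "K \<inter> L = K' \<inter> L'" using xy by simp
    have "interior K \<inter> interior K' = {} \<or> interior L \<inter> interior L' = {}"
    proof (cases "K = K'")
      case True
      then have "L \<noteq> L'" using xy(3) by simp
      then show ?thesis using xy division_ofD(5)[OF q] by simp
    next
      case False
      then show ?thesis using xy division_ofD(5)[OF D] by simp
    qed
    moreover have "interior (K \<inter> L) \<subseteq> interior K \<inter> interior K'" "interior (K \<inter> L) \<subseteq> interior L \<inter> interior L'"
      by (intro Int_greatest interior_mono; use eq in blast)+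
    ultimately have "interior (K \<inter> L) = {}" by blast
    then show "h (case x of (K, L) \<Rightarrow> K \<inter> L) = 0"
      using int[of K L] h0 xy by fastforce
  qed
  also have "\<dots> = (\<Sum>K\<in>D. \<Sum>L\<in>q. h (K \<inter> L))"
    by (simp add: sum.cartesian_product split_def)
  finally show ?thesis .
qed

definition variation_bound :: "(real \<Rightarrow> real) \<Rightarrow> real \<Rightarrow> real \<Rightarrow> real \<Rightarrow> bool" where
  "variation_bound F a b B \<longleftrightarrow> (\<forall>D. D division_of {a..b} \<longrightarrow> (\<Sum>K\<in>D. \<bar>increment F K\<bar>) \<le> B)"

lemma variation_bound_add_linear:
  assumes "variation_bound F a b B" "a \<le> b"
  shows "variation_bound (\<lambda>x. F x - m * x) a b (B + \<bar>m\<bar> * (b - a))"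
  unfolding variation_bound_def
proof (intro allI impI)
  fix D assume D: "D division_of {a..b}"
  have "(\<Sum>K\<in>D. \<bar>increment (\<lambda>x. F x - m * x) K\<bar>) \<le> (\<Sum>K\<in>D. \<bar>increment F K\<bar> + \<bar>m\<bar> * increment (\<lambda>x. x) K)"
  proof (rule sum_mono)
    fix K assume "K \<in> D"
    then obtain u v where K: "u \<le> v" "K = {u..v}"
      by (rule division_of_interval_memE[OF D])
    have "F v - m * v - (F u - m * u) = (F v - F u) - m * (v - u)"
      by (simp add: algebra_simps)
    then have "\<bar>F v - m * v - (F u - m * u)\<bar> \<le> \<bar>F v - F u\<bar> + \<bar>m * (v - u)\<bar>"
      using abs_triangle_ineq4[of "F v - F u" "m * (v - u)"] by metis
    then show "\<bar>increment (\<lambda>x. F x - m * x) K\<bar> \<le> \<bar>increment F K\<bar> + \<bar>m\<bar> * increment (\<lambda>x. x) K"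
      using K by (simp add: increment_interval abs_mult)
  qed
  also have "\<dots> = (\<Sum>K\<in>D. \<bar>increment F K\<bar>) + \<bar>m\<bar> * (b - a)"
    using sum_increment_division[OF D, of "\<lambda>x. x"] assms(2)
    by (simp only: sum.distrib sum_distrib_left[symmetric] increment_interval)
  also have "\<dots> \<le> B + \<bar>m\<bar> * (b - a)"
    using assms(1) D by (simp add: variation_bound_def)
  finally show "(\<Sum>K\<in>D. \<bar>increment (\<lambda>x. F x - m * x) K\<bar>) \<le> B + \<bar>m\<bar> * (b - a)" .
qed

text \<open>The step that drives Austin's argument. Each cell \<open>K\<close> of \<open>D\<close> has a sign \<open>s K\<close>, and \<open>P\<close> consists of
  intervals inside the cells on which \<open>F\<close> moves against that sign with slope at least \<open>c\<close>. When \<open>D\<close> is refined by \<open>P\<close>, the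
  signed increments over a cell still add up to that of the cell, but each interval of \<open>P\<close> enters the sum of absolute
  values with the opposite sign, which gains twice its increment.\<close>

lemma variation_gain:
  fixes F :: "real \<Rightarrow> real"
  assumes B: "variation_bound F a b B" and D: "D division_of {a..b}"
    and s: "\<And>K. K \<in> D \<Longrightarrow> s K * increment F K = \<bar>increment F K\<bar> \<and> \<bar>s K\<bar> = (1::real)"
    and P: "P division_of \<Union>P"
    and PD: "\<And>L. L \<in> P \<Longrightarrow> \<exists>K\<in>D. L \<subseteq> K \<and> s K * increment F L \<le> - c * increment (\<lambda>x. x) L"
    and c: "c > 0"
  shows "(\<Sum>K\<in>D. \<bar>increment F K\<bar>) + 2 * c * (\<Sum>L\<in>P. increment (\<lambda>x. x) L) \<le> B"
proof -
  have "\<Union>P \<subseteq> {a..b}"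
  proof (rule Union_least)
    fix L assume "L \<in> P"
    then obtain K where "K \<in> D" "L \<subseteq> K" using PD by blast
    then show "L \<subseteq> {a..b}" using division_ofD(2)[OF D] by blast
  qed
  then obtain q where q: "P \<subseteq> q" "q division_of {a..b}"
    using partial_division_extend_interval[OF P, of a b] box_real(2)[of a b] by metis
  have finq: "finite q" and finD: "finite D" and finP: "finite P"
    using division_of_finite[OF q(2)] division_of_finite[OF D] division_of_finite[OF P] by simp_all
  define len :: "real set \<Rightarrow> real" where "len = increment (\<lambda>x. x)"
  have len0: "len L \<ge> 0" if Lq: "L \<in> q" for L
  proof -
    obtain u v where "u \<le> v" "L = {u..v}"
      by (rule division_of_interval_memE[OF q(2) Lq])
    then show ?thesis by (simp add: len_def increment_interval)
  qed
  define good where "good K L \<longleftrightarrow> L \<in> P \<and> L \<subseteq> K \<and> s K * increment F L \<le> - c * len L" for K L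
  have main: "\<bar>increment F K\<bar> + 2 * c * (\<Sum>L\<in>{L\<in>q. good K L}. len L)
      \<le> (\<Sum>L\<in>q. \<bar>increment F (K \<inter> L)\<bar>)" if K: "K \<in> D" for K
  proof -
    obtain u v where uv: "u \<le> v" "K = {u..v}" "K \<subseteq> {a..b}"
      using division_of_interval_memE[OF D K] .
    have K1: "{K} division_of {u..v}"
      using uv division_of_self[of u v] by simp
    have div: "{K' \<inter> L | K' L. K' \<in> {K} \<and> L \<in> q \<and> K' \<inter> L \<noteq> {}} division_of {u..v}"
      using division_inter[OF K1 q(2)] uv(2,3) by (simp only: Int_absorb2)
    have "increment F K = (\<Sum>L\<in>q. increment F (K \<inter> L))"
      using sum_increment_division[OF div, of F] uv
        sum_division_inter[OF K1 q(2), of "increment F"] increment_degenerate[of _ _ F]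
      by simp
    then have "\<bar>increment F K\<bar> = (\<Sum>L\<in>q. s K * increment F (K \<inter> L))"
      using s[OF K] by (metis sum_distrib_left)
    moreover have "(\<Sum>L\<in>{L\<in>q. good K L}. len L) = (\<Sum>L\<in>q. if good K L then len L else 0)"
      using finq by (simp add: sum.If_cases Collect_conj_eq Int_commute)
    ultimately have "\<bar>increment F K\<bar> + 2 * c * (\<Sum>L\<in>{L\<in>q. good K L}. len L)
        = (\<Sum>L\<in>q. s K * increment F (K \<inter> L) + 2 * c * (if good K L then len L else 0))"
      by (simp add: sum.distrib sum_distrib_left)
    also have "\<dots> \<le> (\<Sum>L\<in>q. \<bar>increment F (K \<inter> L)\<bar>)"
    proof (rule sum_mono)
      fix L assume L: "L \<in> q"
      have abs: "\<bar>s K * increment F (K \<inter> L)\<bar> = \<bar>increment F (K \<inter> L)\<bar>"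
        using s[OF K] by (simp add: abs_mult)
      show "s K * increment F (K \<inter> L) + 2 * c * (if good K L then len L else 0) \<le> \<bar>increment F (K \<inter> L)\<bar>"
      proof (cases "good K L")
        case True
        then have "K \<inter> L = L" "s K * increment F L \<le> - c * len L" by (auto simp: good_def)
        then show ?thesis
          using abs abs_ge_minus_self[of "s K * increment F (K \<inter> L)"] True by simp
      next
        case False
        then show ?thesis using abs by simp
      qed
    qed
    finally show ?thesis .
  qed
  have "(\<Sum>L\<in>P. len L) \<le> (\<Sum>L\<in>P. \<Sum>K\<in>D. if good K L then len L else 0)"
  proof (rule sum_mono)
    fix L assume L: "L \<in> P"
    then obtain K where K: "K \<in> D" "good K L"
      using PD by (fastforce simp: good_def len_def)
    have "len L \<ge> 0" using L q len0 by auto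
    then have "(if good K L then len L else 0) \<le> (\<Sum>K\<in>D. if good K L then len L else 0)"
      by (intro member_le_sum[where f="\<lambda>K. if good K L then len L else 0", OF K(1) _ finD]) auto
    then show "len L \<le> (\<Sum>K\<in>D. if good K L then len L else 0)" using K by simp
  qed
  also have "\<dots> = (\<Sum>K\<in>D. \<Sum>L\<in>P. if good K L then len L else 0)"
    by (rule sum.swap)
  also have "\<dots> = (\<Sum>K\<in>D. \<Sum>L\<in>{L\<in>q. good K L}. len L)"
  proof (rule sum.cong[OF refl])
    fix K
    have "{L\<in>q. good K L} = {L\<in>P. good K L}" using q by (auto simp: good_def)
    then show "(\<Sum>L\<in>P. if good K L then len L else 0) = (\<Sum>L\<in>{L\<in>q. good K L}. len L)"
      using finP by (simp add: sum.If_cases Collect_conj_eq Int_commute)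
  qed
  finally have "(\<Sum>L\<in>P. len L) \<le> (\<Sum>K\<in>D. \<Sum>L\<in>{L\<in>q. good K L}. len L)" .
  then have "2 * c * (\<Sum>L\<in>P. len L) \<le> 2 * c * (\<Sum>K\<in>D. \<Sum>L\<in>{L\<in>q. good K L}. len L)"
    using c by simp
  then have "(\<Sum>K\<in>D. \<bar>increment F K\<bar>) + 2 * c * (\<Sum>L\<in>P. len L)
      \<le> (\<Sum>K\<in>D. \<bar>increment F K\<bar> + 2 * c * (\<Sum>L\<in>{L\<in>q. good K L}. len L))"
    by (simp add: sum.distrib sum_distrib_left)
  also have "\<dots> \<le> (\<Sum>K\<in>D. \<Sum>L\<in>q. \<bar>increment F (K \<inter> L)\<bar>)"
    by (rule sum_mono) (rule main)
  also have "\<dots> = (\<Sum>M\<in>{K \<inter> L | K L. K \<in> D \<and> L \<in> q \<and> K \<inter> L \<noteq> {}}. \<bar>increment F M\<bar>)"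
    using sum_division_inter[OF D q(2), of "\<lambda>M. \<bar>increment F M\<bar>"] increment_degenerate[of _ _ F]
    by simp
  also have "\<dots> \<le> B"
    using B division_inter[OF D q(2)] unfolding variation_bound_def by simp
  finally show ?thesis by (simp add: len_def)
qed

lemma frequently_quotient_interval:
  fixes F :: "real \<Rightarrow> real"
  assumes "\<exists>\<^sub>F y in at x. P ((F y - F x) / (y - x))" "d > 0"
  obtains u v where "u < v" "x \<in> {u..v}" "v - u < d" "P ((F v - F u) / (v - u))"
proof -
  have "\<exists>\<^sub>F y in at x. P ((F y - F x) / (y - x)) \<and> dist y x < d \<and> y \<noteq> x"
  proof (rule frequently_eventually_conj[OF assms(1), THEN frequently_elim1])
    show "\<forall>\<^sub>F y in at x. dist y x < d \<and> y \<noteq> x"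
      using assms(2) by (auto simp: eventually_at)
  qed auto
  then obtain y where y: "P ((F y - F x) / (y - x))" "dist y x < d" "y \<noteq> x"
    using frequently_ex by blast
  show thesis
  proof (cases "x < y")
    case True
    then show thesis using that[of x y] y by (simp add: dist_real_def)
  next
    case False
    have "(F y - F x) / (y - x) = (F x - F y) / (x - y)"
      using minus_divide_divide[of "F y - F x" "y - x"] by simp
    then show thesis using that[of y x] False y by (simp add: dist_real_def)
  qed
qed

text \<open>Vitali's covering theorem in the form needed here: a bound for the total length of finite
  families of non-overlapping intervals with property \<open>Q\<close> bounds the outer measure of every set that such intervals
  cover finely.\<close>

lemma interval_cover_outer_bound:
  fixes S :: "real set" and Q :: "real \<Rightarrow> real \<Rightarrow> bool"
  assumes fine: "\<And>x d. x \<in> S \<Longrightarrow> d > 0 \<Longrightarrow> \<exists>u v. u < v \<and> x \<in> {u..v} \<and> v - u < d \<and> Q u v"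
    and small: "\<And>P. P division_of \<Union>P \<Longrightarrow> (\<And>L. L \<in> P \<Longrightarrow> \<exists>u v. u < v \<and> L = {u..v} \<and> Q u v)
        \<Longrightarrow> (\<Sum>L\<in>P. increment (\<lambda>x. x) L) \<le> e"
  shows "\<exists>T. S \<subseteq> T \<and> T \<in> lmeasurable \<and> measure lebesgue T \<le> e"
proof -
  define K where "K = {(u, v). u < v \<and> Q u v}"
  define a r :: "real \<times> real \<Rightarrow> real" where "a = (\<lambda>(u, v). (u + v) / 2)" and "r = (\<lambda>(u, v). (v - u) / 2)"
  have cb: "cball (a i) (r i) = {fst i..snd i}" for i
    by (cases i) (simp add: cball_eq_atLeastAtMost a_def r_def field_simps)
  obtain C where C: "countable C" "C \<subseteq> K"
     "pairwise (\<lambda>i j. disjnt (cball (a i) (r i)) (cball (a j) (r j))) C"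
     "negligible (S - (\<Union>i \<in> C. cball (a i) (r i)))"
  proof (rule Vitali_covering_theorem_cballs[of K r S a])
    fix i assume "i \<in> K" then show "0 < r i" by (auto simp: K_def r_def)
  next
    fix x d :: real assume "x \<in> S" "0 < d"
    then obtain u v where "u < v" "x \<in> {u..v}" "v - u < d" "Q u v" using fine by blast
    then have "(u, v) \<in> K \<and> x \<in> cball (a (u, v)) (r (u, v)) \<and> r (u, v) < d"
      unfolding cb by (auto simp: K_def r_def)
    then show "\<exists>i. i \<in> K \<and> x \<in> cball (a i) (r i) \<and> r i < d" by blast
  qed
  define A where "A i = {fst i..snd i}" for i :: "real \<times> real"
  have bound: "measure lebesgue (\<Union>i\<in>I. A i) \<le> e" if I: "I \<subseteq> C" "finite I" for I
  proof -
    have nonempty: "fst i < snd i" if "i \<in> I" for i using that I C(2) by (auto simp: K_def)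
    have disj: "A i \<inter> A j = {}" if "i \<in> I" "j \<in> I" "i \<noteq> j" for i j
      using C(3) that I unfolding pairwise_def cb A_def disjnt_def by blast
    have inj: "inj_on A I"
    proof (rule inj_onI, rule ccontr)
      fix i j assume ij: "i \<in> I" "j \<in> I" "A i = A j" "i \<noteq> j"
      then have "A i = {}" using disj[of i j] by simp
      then show False using nonempty[OF ij(1)] by (simp add: A_def)
    qed
    have "measure lebesgue (\<Union>i\<in>I. A i) \<le> (\<Sum>i\<in>I. measure lebesgue (A i))"
      by (rule measure_UNION_le[OF I(2)]) (simp add: A_def)
    also have "\<dots> = (\<Sum>i\<in>I. increment (\<lambda>x. x) (A i))"
      using nonempty by (intro sum.cong) (simp_all add: A_def increment_interval less_imp_le)
    also have "\<dots> = (\<Sum>L\<in>A ` I. increment (\<lambda>x. x) L)"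
      using inj by (simp add: sum.reindex)
    also have "\<dots> \<le> e"
    proof (rule small)
      show "(A ` I) division_of \<Union>(A ` I)"
      proof (rule division_ofI)
        fix K assume "K \<in> A ` I"
        then obtain i where i: "i \<in> I" "K = A i" by blast
        show "K \<subseteq> \<Union>(A ` I)" using i by blast
        show "K \<noteq> {}" using nonempty[OF i(1)] i by (simp add: A_def)
        show "\<exists>a b. K = cbox a b" using i by (auto simp: A_def)
      next
        fix K L assume "K \<in> A ` I" "L \<in> A ` I" "K \<noteq> L"
        then have "K \<inter> L = {}" using disj by blast
        then show "interior K \<inter> interior L = {}" using interior_subset by blast
      qed (use I in auto)
      fix L assume "L \<in> A ` I"
      then obtain i where i: "i \<in> I" "L = A i" by blast
      then have "i \<in> K" using I C(2) by blast
      then show "\<exists>u v. u < v \<and> L = {u..v} \<and> Q u v" using i by (cases i) (auto simp: K_def A_def)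
    qed
    finally show ?thesis .
  qed
  have meas: "A i \<in> lmeasurable" for i by (simp add: A_def)
  define N where "N = S - (\<Union>i\<in>C. A i)"
  have N: "negligible N" using C(4) by (simp add: N_def cb A_def)
  have T: "(\<Union>i\<in>C. A i) \<in> lmeasurable" "measure lebesgue (\<Union>i\<in>C. A i) \<le> e"
    using fmeasurable_UN_bound[OF C(1) meas bound] measure_UN_bound[OF C(1) meas bound] by blast+
  have "(\<Union>i\<in>C. A i) \<union> N \<in> lmeasurable"
    using T N by (simp add: fmeasurable.Un negligible_iff_measure)
  moreover have "measure lebesgue ((\<Union>i\<in>C. A i) \<union> N) \<le> e"
    using measure_Un_le[of "\<Union>i\<in>C. A i" lebesgue N] T N by (auto simp: negligible_iff_measure fmeasurableD)
  moreover have "S \<subseteq> (\<Union>i\<in>C. A i) \<union> N" by (auto simp: N_def)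
  ultimately show ?thesis by blast
qed

text \<open>Disjoint intervals on which the slope exceeds \<open>M\<close> have total length at most \<open>B / M\<close>.\<close>

lemma negligible_unbounded_quotients:
  fixes F :: "real \<Rightarrow> real"
  assumes B: "variation_bound F a b B" and "a \<le> b"
  shows "negligible {x\<in>{a<..<b}. \<forall>M. \<exists>\<^sub>F y in at x. \<bar>(F y - F x) / (y - x)\<bar> > M}"
    (is "negligible ?S")
  unfolding negligible_outer_le
proof (intro allI impI)
  fix e :: real assume e: "e > 0"
  define M where "M = (\<bar>B\<bar> + 1) / e"
  have M: "M > 0" using e by (simp add: M_def)
  show "\<exists>T. ?S \<subseteq> T \<and> T \<in> lmeasurable \<and> measure lebesgue T \<le> e"
  proof (rule interval_cover_outer_bound[where Q = "\<lambda>u v. {u..v} \<subseteq> {a..b} \<and> \<bar>(F v - F u) / (v - u)\<bar> > M"])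
    fix x d :: real assume x: "x \<in> ?S" and d: "d > 0"
    define d' where "d' = min d (min (x - a) (b - x))"
    have d': "d' > 0" using x d by (simp add: d'_def)
    have "\<exists>\<^sub>F y in at x. \<bar>(F y - F x) / (y - x)\<bar> > M" using x by blast
    then obtain u v where uv: "u < v" "x \<in> {u..v}" "v - u < d'" "\<bar>(F v - F u) / (v - u)\<bar> > M"
      using frequently_quotient_interval[where P = "\<lambda>q. \<bar>q\<bar> > M" and x = x and d = d' and F = F] d' by blast
    have "{u..v} \<subseteq> {a..b}" "v - u < d" using uv by (auto simp: d'_def)
    then show "\<exists>u v. u < v \<and> x \<in> {u..v} \<and> v - u < d \<and> {u..v} \<subseteq> {a..b} \<and> \<bar>(F v - F u) / (v - u)\<bar> > M"
      using uv by blast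
  next
    fix P assume P: "P division_of \<Union>P"
      and L: "\<And>L. L \<in> P \<Longrightarrow> \<exists>u v. u < v \<and> L = {u..v} \<and> {u..v} \<subseteq> {a..b} \<and> \<bar>(F v - F u) / (v - u)\<bar> > M"
    have "\<Union>P \<subseteq> cbox a b" using L by fastforce
    then obtain q where q: "P \<subseteq> q" "q division_of cbox a b"
      using partial_division_extend_interval[OF P] by blast
    have "M * (\<Sum>L\<in>P. increment (\<lambda>x. x) L) = (\<Sum>L\<in>P. M * increment (\<lambda>x. x) L)"
      by (rule sum_distrib_left)
    also have "\<dots> \<le> (\<Sum>L\<in>P. \<bar>increment F L\<bar>)"
    proof (rule sum_mono)
      fix L' assume "L' \<in> P"
      then obtain u v where uv: "u < v" "L' = {u..v}" "\<bar>(F v - F u) / (v - u)\<bar> > M" using L by blast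
      then show "M * increment (\<lambda>x. x) L' \<le> \<bar>increment F L'\<bar>"
        by (simp add: increment_interval abs_divide field_simps)
    qed
    also have "\<dots> \<le> (\<Sum>L\<in>q. \<bar>increment F L\<bar>)"
      using q division_of_finite[OF q(2)] by (intro sum_mono2) auto
    also have "\<dots> \<le> B" using B q(2) by (simp add: variation_bound_def)
    also have "\<dots> \<le> M * e" using e by (simp add: M_def)
    finally show "(\<Sum>L\<in>P. increment (\<lambda>x. x) L) \<le> e" using M by simp
  qed
qed

text \<open>Choose a division \<open>D\<close> whose variation is within \<open>2 c e\<close> of the supremum. By
  \<open>variation_gain\<close>, disjoint intervals inside the cells of \<open>D\<close> whose slope opposes that of their cell have
  total length at most \<open>e\<close>. A point of oscillation has arbitrarily short intervals of either slope around it, hence of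
  the opposing one, so such points in the interiors of the cells have outer measure at most \<open>e\<close>, and the
  remaining ones are finitely many end points.\<close>

lemma negligible_oscillating_quotients:
  fixes F :: "real \<Rightarrow> real"
  assumes B: "variation_bound F a b B" and c: "c > 0"
  shows "negligible {x\<in>{a<..<b}. (\<exists>\<^sub>F y in at x. (F y - F x) / (y - x) > c)
      \<and> (\<exists>\<^sub>F y in at x. (F y - F x) / (y - x) < - c)}" (is "negligible ?S")
  unfolding negligible_outer_le
proof (intro allI impI)
  fix e :: real assume e: "e > 0"
  define total where "total D = (\<Sum>K\<in>D. \<bar>increment F K\<bar>)" for D
  define V where "V = (SUP D\<in>{D. D division_of {a..b}}. total D)"
  have bdd: "bdd_above (total ` {D. D division_of {a..b}})"
    using B by (auto simp: variation_bound_def total_def intro!: bdd_aboveI2)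
  have ne: "{D. D division_of {a..b}} \<noteq> {}"
    using elementary_interval[of a b] by auto
  have V: "variation_bound F a b V"
    unfolding variation_bound_def V_def using cSUP_upper[OF _ bdd] by (auto simp: total_def)
  \<comment> \<open>A deficit of \<open>2 c e\<close> is what opposing intervals of total length \<open>e\<close> would gain.\<close>
  have "V - 2 * c * e < V" using c e by simp
  then obtain D where D: "D division_of {a..b}" "V - 2 * c * e < total D"
    using less_cSUP_iff[OF ne bdd, of "V - 2 * c * e"] by (auto simp: V_def)
  define s where "s K = (if increment F K \<ge> 0 then 1 else - 1 :: real)" for K
  define S where "S = ?S \<inter> \<Union>(interior ` D)"
  have "\<exists>T. S \<subseteq> T \<and> T \<in> lmeasurable \<and> measure lebesgue T \<le> e"
  proof (rule interval_cover_outer_bound[where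
        Q = "\<lambda>u v. \<exists>K\<in>D. {u..v} \<subseteq> K \<and> s K * (F v - F u) / (v - u) < - c"])
    fix x d :: real assume x: "x \<in> S" and d: "d > 0"
    then obtain K where K: "K \<in> D" "x \<in> interior K" by (auto simp: S_def)
    then obtain r where r: "r > 0" "ball x r \<subseteq> K" by (auto simp: mem_interior)
    have "\<exists>\<^sub>F y in at x. s K * ((F y - F x) / (y - x)) < - c"
    proof (cases "increment F K \<ge> 0")
      case True
      then show ?thesis using x by (simp add: S_def s_def)
    next
      case False
      then show ?thesis using x by (simp add: S_def s_def del: minus_divide_left minus_diff_eq)
    qed
    then obtain u v where uv: "u < v" "x \<in> {u..v}" "v - u < min d r" "s K * ((F v - F u) / (v - u)) < - c"
      using frequently_quotient_interval[where P = "\<lambda>q. s K * q < - c" and x = x and d = "min d r" and F = F] d r by auto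
    have "{u..v} \<subseteq> ball x r" using uv by (auto simp: dist_real_def)
    then show "\<exists>u v. u < v \<and> x \<in> {u..v} \<and> v - u < d \<and> (\<exists>K\<in>D. {u..v} \<subseteq> K \<and> s K * (F v - F u) / (v - u) < - c)"
      using uv K r by (intro exI[of _ u] exI[of _ v]) auto
  next
    fix P assume P: "P division_of \<Union>P"
      and L: "\<And>L. L \<in> P \<Longrightarrow> \<exists>u v. u < v \<and> L = {u..v} \<and> (\<exists>K\<in>D. {u..v} \<subseteq> K \<and> s K * (F v - F u) / (v - u) < - c)"
    have "total D + 2 * c * (\<Sum>L\<in>P. increment (\<lambda>x. x) L) \<le> V"
      unfolding total_def
    proof (rule variation_gain[OF V D(1) _ P _ c, where s = s])
      fix L' assume "L' \<in> P"
      then obtain u v K where uv: "u < v" "L' = {u..v}" "K \<in> D" "{u..v} \<subseteq> K" "s K * (F v - F u) / (v - u) < - c"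
        using L by blast
      then have "s K * increment F L' \<le> - c * increment (\<lambda>x. x) L'"
        by (simp add: increment_interval field_simps)
      then show "\<exists>K\<in>D. L' \<subseteq> K \<and> s K * increment F L' \<le> - c * increment (\<lambda>x. x) L'"
        using uv by blast
    qed (auto simp: s_def)
    then have "2 * c * (\<Sum>L\<in>P. increment (\<lambda>x. x) L) \<le> 2 * c * e" using D(2) by simp
    then show "(\<Sum>L\<in>P. increment (\<lambda>x. x) L) \<le> e" using c by simp
  qed
  then obtain T where T: "S \<subseteq> T" "T \<in> lmeasurable" "measure lebesgue T \<le> e" by blast
  define N where "N = \<Union>(frontier ` D)"
  have N: "negligible N"
    unfolding N_def
  proof (rule negligible_Union)
    show "finite (frontier ` D)" using division_of_finite[OF D(1)] by simp
    fix X assume "X \<in> frontier ` D"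
    then obtain K where K: "K \<in> D" "X = frontier K" by blast
    then obtain u v where "K = cbox u v" using division_ofD(4)[OF D(1)] by blast
    then show "negligible X" using K by (simp add: negligible_convex_frontier)
  qed
  have "?S \<subseteq> S \<union> N"
  proof
    fix x assume x: "x \<in> ?S"
    then have "x \<in> \<Union>D" using division_ofD(6)[OF D(1)] by auto
    then obtain K where K: "K \<in> D" "x \<in> K" by blast
    then have "x \<in> interior K \<or> x \<in> frontier K"
      using closure_subset by (auto simp: frontier_def)
    then show "x \<in> S \<union> N" using x K by (auto simp: S_def N_def)
  qed
  then have "?S \<subseteq> T \<union> N" using T(1) by blast
  moreover have "T \<union> N \<in> lmeasurable"
    using T N by (simp add: fmeasurable.Un negligible_iff_measure)
  moreover have "measure lebesgue (T \<union> N) \<le> e"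
    using measure_Un_le[of T lebesgue N] T N by (auto simp: negligible_iff_measure fmeasurableD)
  ultimately show "\<exists>T. ?S \<subseteq> T \<and> T \<in> lmeasurable \<and> measure lebesgue T \<le> e" by blast
qed

text \<open>Where the derivative does not exist, either the difference quotients are unbounded
  or some rational interval \<open>[m - c, m + c]\<close> is crossed infinitely often. The crossing reduces to the symmetric
  oscillation above after \<open>m x\<close> is subtracted from \<open>F\<close>.\<close>

theorem bounded_variation_imp_differentiable_ae:
  fixes F :: "real \<Rightarrow> real"
  assumes B: "variation_bound F a b B"
  shows "negligible {x\<in>{a<..<b}. \<not> F differentiable (at x)}"
proof (cases "a \<le> b")
  case ab: True
  define q where "q x y = (F y - F x) / (y - x)" for x y
  define U where "U = {x\<in>{a<..<b}. \<forall>M. \<exists>\<^sub>F y in at x. \<bar>q x y\<bar> > M}"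
  define O' where "O' m c = {x\<in>{a<..<b}. (\<exists>\<^sub>F y in at x. q x y > m + c) \<and> (\<exists>\<^sub>F y in at x. q x y < m - c)}" for m c
  have negU: "negligible U"
    using negligible_unbounded_quotients[OF B ab] by (simp add: U_def q_def)
  have negO: "negligible (O' m c)" if "c > 0" for m c
  proof -
    have ev: "\<forall>\<^sub>F y in at x. ((F y - m * y) - (F x - m * x)) / (y - x) = q x y - m" for x
      by (auto simp: eventually_at q_def field_simps intro!: exI[of _ 1])
    have eq: "(\<exists>\<^sub>F y in at x. P (((F y - m * y) - (F x - m * x)) / (y - x))) = (\<exists>\<^sub>F y in at x. P (q x y - m))" for x P
      by (rule frequently_cong[OF ev]) simp
    show ?thesis
      using negligible_oscillating_quotients[OF variation_bound_add_linear[OF B ab, of m] that]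
      unfolding eq[of "\<lambda>z. z > c"] eq[of "\<lambda>z. z < - c"]
      by (simp add: O'_def less_diff_eq diff_less_eq algebra_simps)
  qed
  have "{x\<in>{a<..<b}. \<not> F differentiable (at x)}
      \<subseteq> U \<union> (\<Union>(m, c)\<in>{(m, c). m \<in> \<rat> \<and> c \<in> \<rat> \<and> c > 0}. O' m c)"
  proof
    fix x assume x: "x \<in> {x\<in>{a<..<b}. \<not> F differentiable (at x)}"
    show "x \<in> U \<union> (\<Union>(m, c)\<in>{(m, c). m \<in> \<rat> \<and> c \<in> \<rat> \<and> c > 0}. O' m c)"
    proof (rule ccontr)
      assume neg: "x \<notin> U \<union> (\<Union>(m, c)\<in>{(m, c). m \<in> \<rat> \<and> c \<in> \<rat> \<and> c > 0}. O' m c)"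
      then obtain M where M: "\<forall>\<^sub>F y in at x. \<bar>q x y\<bar> \<le> M"
        using x by (auto simp: U_def not_frequently not_less)
      define l where "l = Liminf (at x) (\<lambda>y. ereal (q x y))"
      define L where "L = Limsup (at x) (\<lambda>y. ereal (q x y))"
      have "l \<le> L" unfolding l_def L_def by (rule Liminf_le_Limsup) simp
      have "L \<le> ereal M" unfolding L_def
        by (rule Limsup_bounded) (use M in \<open>auto elim: eventually_mono\<close>)
      have "ereal (- M) \<le> l" unfolding l_def
        by (rule Liminf_bounded) (use M in \<open>auto elim: eventually_mono\<close>)
      have "\<not> l < L"
      proof
        assume "l < L"
        then obtain p :: rat where p: "l < ereal (of_rat p)" "ereal (of_rat p) < L"
          using ereal_dense3 by blast
        obtain r :: rat where r: "ereal (of_rat p) < ereal (of_rat r)" "ereal (of_rat r) < L"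
          using ereal_dense3[OF p(2)] by blast
        \<comment> \<open>The crossed interval \<open>[p, r]\<close> has midpoint \<open>m\<close> and half-length \<open>c\<close>.\<close>
        define m where "m = (of_rat p + of_rat r) / (2::real)"
        define c where "c = (of_rat r - of_rat p) / (2::real)"
        have mc: "m \<in> \<rat>" "c \<in> \<rat>" "c > 0" "m - c = of_rat p" "m + c = of_rat r"
          using r by (auto simp: m_def c_def field_simps)
        have "\<exists>\<^sub>F y in at x. q x y < m - c"
        proof (rule ccontr)
          assume "\<not> ?thesis"
          then have "\<forall>\<^sub>F y in at x. ereal (of_rat p) \<le> ereal (q x y)"
            by (simp add: not_frequently not_less mc)
          then have "ereal (of_rat p) \<le> l" unfolding l_def by (rule Liminf_bounded)
          then show False using p by simp
        qed
        moreover have "\<exists>\<^sub>F y in at x. q x y > m + c"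
        proof (rule ccontr)
          assume "\<not> ?thesis"
          then have "\<forall>\<^sub>F y in at x. ereal (q x y) \<le> ereal (of_rat r)"
            by (simp add: not_frequently not_less mc)
          then have "L \<le> ereal (of_rat r)" unfolding L_def by (rule Limsup_bounded)
          then show False using r by simp
        qed
        ultimately have "x \<in> O' m c" using x by (simp add: O'_def)
        then show False using neg mc by blast
      qed
      then have "l = L" using \<open>l \<le> L\<close> by simp
      moreover obtain d where "L = ereal d"
        using \<open>L \<le> ereal M\<close> \<open>ereal (- M) \<le> l\<close> \<open>l = L\<close> by (cases L) auto
      ultimately have "((\<lambda>y. ereal (q x y)) \<longlongrightarrow> ereal d) (at x)"
        by (subst tendsto_iff_Liminf_eq_Limsup) (auto simp: l_def L_def)
      then have "(q x \<longlongrightarrow> d) (at x)" by simp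
      then have "(F has_real_derivative d) (at x)"
        by (simp add: has_field_derivative_iff q_def[abs_def])
      then show False using x by (auto simp: real_differentiable_def)
    qed
  qed
  moreover have "negligible (U \<union> (\<Union>(m, c)\<in>{(m, c). m \<in> \<rat> \<and> c \<in> \<rat> \<and> c > 0}. O' m c))"
  proof -
    have "countable (\<rat> \<times> \<rat> :: (real \<times> real) set)" by (intro countable_SIGMA countable_rat)
    then have "countable {(m :: real, c :: real). m \<in> \<rat> \<and> c \<in> \<rat> \<and> c > 0}"
      by (rule countable_subset[rotated]) auto
    then show ?thesis
      using negU negO by (intro negligible_Un negligible_countable_Union countable_image) auto
  qed
  ultimately show ?thesis by (rule negligible_subset[rotated])
qed simp

section \<open>Absolutely continuous functions and the fundamental theorem of calculus\<close>

text \<open>The same notion as \<^const>\<open>absolutely_continuous_on_interval\<close>, but for values in an arbitrary normed space: it is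
  also applied to the real-valued function whose derivative is the mixed energy density.\<close>

definition abs_cont :: "(real \<Rightarrow> 'a::real_normed_vector) \<Rightarrow> real \<Rightarrow> real \<Rightarrow> bool" where
  "abs_cont g a b \<longleftrightarrow>
     (\<forall>e>0. \<exists>d>0. \<forall>D. D division_of \<Union>D \<and> \<Union>D \<subseteq> {a..b} \<and> (\<Sum>K\<in>D. increment (\<lambda>x. x) K) < d
        \<longrightarrow> (\<Sum>K\<in>D. norm (increment g K)) < e)"

lemma abs_cont_iff:
  "abs_cont g a b \<longleftrightarrow> absolutely_continuous_on_interval g a b"
proof -
  have "(\<Sum>K\<in>D. increment (\<lambda>x. x) K) = (\<Sum>K\<in>D. Sup K - Inf K)"
    "(\<Sum>K\<in>D. norm (increment g K)) = (\<Sum>K\<in>D. norm (g (Sup K) - g (Inf K)))"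
    if "D division_of \<Union>D" for D :: "real set set"
    using division_ofD(3)[OF that] by (auto intro!: sum.cong simp: increment_def)
  then show ?thesis
    unfolding abs_cont_def absolutely_continuous_on_interval_def by (auto cong: conj_cong)
qed

text \<open>A common source for the closure properties below: sums, inner products of bounded functions, real and
  imaginary parts, and Lipschitz functions all have increments dominated in this way.\<close>

lemma abs_cont_dominated:
  assumes f: "abs_cont f a b" and g: "abs_cont g a b" and M: "M \<ge> 0"
    and le: "\<And>u v. a \<le> u \<Longrightarrow> u \<le> v \<Longrightarrow> v \<le> b \<Longrightarrow>
      norm (h v - h u) \<le> M * (norm (f v - f u) + norm (g v - g u))"
  shows "abs_cont h a b"
  unfolding abs_cont_def
proof (intro allI impI)
  fix e :: real assume e: "e > 0"
  define e' where "e' = e / (2 * (M + 1))"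
  have e': "e' > 0" "M * (2 * e') < e" using e M by (auto simp: e'_def field_simps)
  obtain d1 where d1: "d1 > 0" "\<And>D. D division_of \<Union>D \<Longrightarrow> \<Union>D \<subseteq> {a..b} \<Longrightarrow> (\<Sum>K\<in>D. increment (\<lambda>x. x) K) < d1
        \<Longrightarrow> (\<Sum>K\<in>D. norm (increment f K)) < e'"
    using f e'(1) unfolding abs_cont_def by meson
  obtain d2 where d2: "d2 > 0" "\<And>D. D division_of \<Union>D \<Longrightarrow> \<Union>D \<subseteq> {a..b} \<Longrightarrow> (\<Sum>K\<in>D. increment (\<lambda>x. x) K) < d2
        \<Longrightarrow> (\<Sum>K\<in>D. norm (increment g K)) < e'"
    using g e'(1) unfolding abs_cont_def by meson
  show "\<exists>d>0. \<forall>D. D division_of \<Union>D \<and> \<Union>D \<subseteq> {a..b} \<and> (\<Sum>K\<in>D. increment (\<lambda>x. x) K) < d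
        \<longrightarrow> (\<Sum>K\<in>D. norm (increment h K)) < e"
  proof (intro exI[of _ "min d1 d2"] conjI allI impI)
    fix D :: "real set set"
    assume D: "D division_of \<Union>D \<and> \<Union>D \<subseteq> {a..b} \<and> (\<Sum>K\<in>D. increment (\<lambda>x. x) K) < min d1 d2"
    have "(\<Sum>K\<in>D. norm (increment h K)) \<le> (\<Sum>K\<in>D. M * (norm (increment f K) + norm (increment g K)))"
    proof (rule sum_mono)
      fix K assume "K \<in> D"
      then obtain u v where uv: "u \<le> v" "K = {u..v}" "K \<subseteq> \<Union>D"
        using D division_of_interval_memE[of D "\<Union>D" K] by metis
      then have "{u..v} \<subseteq> {a..b}" using D by blast
      then have "a \<le> u" "v \<le> b" using uv(1) by auto
      then show "norm (increment h K) \<le> M * (norm (increment f K) + norm (increment g K))"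
        using le uv by (simp add: increment_interval)
    qed
    also have "\<dots> = M * ((\<Sum>K\<in>D. norm (increment f K)) + (\<Sum>K\<in>D. norm (increment g K)))"
      by (simp only: sum.distrib sum_distrib_left[symmetric])
    also have "\<dots> \<le> M * (e' + e')"
      using d1(2)[of D] d2(2)[of D] D M by (intro mult_left_mono add_mono) auto
    also have "\<dots> < e" using e' by simp
    finally show "(\<Sum>K\<in>D. norm (increment h K)) < e" .
  qed (use d1 d2 in auto)
qed

lemma abs_cont_lipschitz:
  assumes M: "M \<ge> 0" and le: "\<And>u v. a \<le> u \<Longrightarrow> u \<le> v \<Longrightarrow> v \<le> b \<Longrightarrow> norm (h v - h u) \<le> M * (v - u)"
  shows "abs_cont h a b"
proof -
  have "norm (increment (\<lambda>x::real. x) K) = increment (\<lambda>x. x) K"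
    if "D division_of \<Union>D" "K \<in> D" for D :: "real set set" and K
    using division_of_interval_memE[OF that] by (metis abs_of_nonneg diff_ge_0_iff_ge increment_interval real_norm_def)
  then have "(\<Sum>K\<in>D. norm (increment (\<lambda>x::real. x) K)) = (\<Sum>K\<in>D. increment (\<lambda>x. x) K)"
    if "D division_of \<Union>D" for D :: "real set set"
    using that by (intro sum.cong) auto
  then have id: "abs_cont (\<lambda>x::real. x) a b"
    unfolding abs_cont_def by (intro allI impI, rule_tac x = e in exI) auto
  show ?thesis
  proof (rule abs_cont_dominated[OF id id M])
    fix u v assume "a \<le> u" "u \<le> v" "v \<le> b"
    then have "norm (h v - h u) \<le> M * (v - u)" by (rule le)
    also have "\<dots> \<le> M * ((v - u) + (v - u))" using M \<open>u \<le> v\<close> by (intro mult_left_mono) auto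
    finally show "norm (h v - h u) \<le> M * (norm (v - u) + norm (v - u))" using \<open>u \<le> v\<close> by simp
  qed
qed

lemma abs_cont_add:
  assumes "abs_cont f a b" "abs_cont g a b"
  shows "abs_cont (\<lambda>x. f x + g x) a b"
  by (rule abs_cont_dominated[OF assms, of 1])
    (auto simp: add_diff_add intro: norm_triangle_ineq)

lemma abs_cont_inner:
  fixes f g :: "real \<Rightarrow> 'a::real_inner"
  assumes "abs_cont f a b" "abs_cont g a b"
    and bf: "\<And>x. x \<in> {a..b} \<Longrightarrow> norm (f x) \<le> M" and bg: "\<And>x. x \<in> {a..b} \<Longrightarrow> norm (g x) \<le> M"
  shows "abs_cont (\<lambda>x. f x \<bullet> g x) a b"
proof (rule abs_cont_dominated[OF assms(1,2), of "max M 0"])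
  fix u v assume uv: "a \<le> u" "u \<le> v" "v \<le> b"
  have "f v \<bullet> g v - f u \<bullet> g u = (f v - f u) \<bullet> g v + f u \<bullet> (g v - g u)"
    by (simp add: inner_diff_left inner_diff_right)
  also have "norm \<dots> \<le> norm (f v - f u) * norm (g v) + norm (f u) * norm (g v - g u)"
    by (rule order_trans[OF norm_triangle_ineq]) (auto intro!: add_mono Cauchy_Schwarz_ineq2)
  also have "\<dots> \<le> norm (f v - f u) * max M 0 + max M 0 * norm (g v - g u)"
    using bf[of u] bg[of v] uv by (intro add_mono mult_left_mono mult_right_mono) auto
  finally show "norm (f v \<bullet> g v - f u \<bullet> g u) \<le> max M 0 * (norm (f v - f u) + norm (g v - g u))"
    by (simp add: algebra_simps)
qed simp

text \<open>On an interval shorter than the \<open>\<delta>\<close> that belongs to \<open>\<epsilon> = 1\<close> the variation is at most 1;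
  countably many such intervals with rational end points cover the open interval.\<close>

lemma abs_cont_real_differentiable_ae:
  fixes F :: "real \<Rightarrow> real"
  assumes "abs_cont F a b"
  shows "negligible {x\<in>{a<..<b}. \<not> F differentiable (at x)}"
proof -
  obtain d where d: "d > 0" "\<And>D. D division_of \<Union>D \<Longrightarrow> \<Union>D \<subseteq> {a..b} \<Longrightarrow> (\<Sum>K\<in>D. increment (\<lambda>x. x) K) < d
        \<Longrightarrow> (\<Sum>K\<in>D. norm (increment F K)) < 1"
    using assms unfolding abs_cont_def by (meson zero_less_one)
  define I where "I = {(u, v). u \<in> \<rat> \<and> v \<in> \<rat> \<and> a \<le> u \<and> u \<le> v \<and> v \<le> b \<and> v - u < d}"
  define E where "E = (\<lambda>(u, v). {x\<in>{u<..<v}. \<not> F differentiable (at x)})"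
  have "negligible (E i)" if "i \<in> I" for i
  proof -
    obtain u v where uv: "i = (u, v)" "a \<le> u" "u \<le> v" "v \<le> b" "v - u < d"
      using \<open>i \<in> I\<close> by (auto simp: I_def)
    have "variation_bound F u v 1"
      unfolding variation_bound_def
    proof (intro allI impI)
      fix D assume D: "D division_of {u..v}"
      have D': "\<Union>D = {u..v}" using division_ofD(6)[OF D] .
      then have "(\<Sum>K\<in>D. norm (increment F K)) < 1"
        using D uv sum_increment_division[OF D, of "\<lambda>x. x"]
        by (intro d(2)) (auto simp: increment_interval)
      then show "(\<Sum>K\<in>D. \<bar>increment F K\<bar>) \<le> 1" by simp
    qed
    then show ?thesis
      using bounded_variation_imp_differentiable_ae uv by (simp add: E_def)
  qed
  moreover have "countable I"
  proof -
    have "countable (\<rat> \<times> \<rat> :: (real \<times> real) set)" by (intro countable_SIGMA countable_rat)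
    then show ?thesis by (rule countable_subset[rotated]) (auto simp: I_def)
  qed
  ultimately have "negligible (\<Union>i\<in>I. E i)"
    by (intro negligible_countable_Union countable_image) auto
  moreover have "{x\<in>{a<..<b}. \<not> F differentiable (at x)} \<subseteq> (\<Union>i\<in>I. E i)"
  proof
    fix x assume x: "x \<in> {x\<in>{a<..<b}. \<not> F differentiable (at x)}"
    obtain u where u: "u \<in> \<rat>" "max a (x - d / 2) < u" "u < x"
      using Rats_dense_in_real[of "max a (x - d / 2)" x] x d by auto
    obtain v where v: "v \<in> \<rat>" "x < v" "v < min b (x + d / 2)"
      using Rats_dense_in_real[of x "min b (x + d / 2)"] x d by auto
    have "(u, v) \<in> I" "x \<in> E (u, v)" using u v x by (auto simp: I_def E_def)
    then show "x \<in> (\<Union>i\<in>I. E i)" by blast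
  qed
  ultimately show ?thesis by (rule negligible_subset)
qed

theorem abs_cont_has_vector_derivative_ae:
  fixes F :: "real \<Rightarrow> complex"
  assumes F: "abs_cont F a b"
  shows "negligible {x\<in>{a..b}. \<not> (F has_vector_derivative vector_derivative F (at x)) (at x)}"
proof -
  have Re: "abs_cont (\<lambda>x. Re (F x)) a b"
  proof (rule abs_cont_dominated[OF F F, of 1])
    show "norm (Re (F v) - Re (F u)) \<le> 1 * (norm (F v - F u) + norm (F v - F u))" for u v
      using abs_Re_le_cmod[of "F v - F u"] norm_ge_zero[of "F v - F u"] by simp
  qed simp
  have Im: "abs_cont (\<lambda>x. Im (F x)) a b"
  proof (rule abs_cont_dominated[OF F F, of 1])
    show "norm (Im (F v) - Im (F u)) \<le> 1 * (norm (F v - F u) + norm (F v - F u))" for u v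
      using abs_Im_le_cmod[of "F v - F u"] norm_ge_zero[of "F v - F u"] by simp
  qed simp
  have "negligible ({a, b} \<union> ({x\<in>{a<..<b}. \<not> (\<lambda>x. Re (F x)) differentiable (at x)} \<union>
      {x\<in>{a<..<b}. \<not> (\<lambda>x. Im (F x)) differentiable (at x)}))"
    using abs_cont_real_differentiable_ae[OF Re] abs_cont_real_differentiable_ae[OF Im]
    by (intro negligible_Un) auto
  then show ?thesis
  proof (rule negligible_subset, intro subsetI)
    fix x assume x: "x \<in> {x\<in>{a..b}. \<not> (F has_vector_derivative vector_derivative F (at x)) (at x)}"
    show "x \<in> {a, b} \<union> ({x\<in>{a<..<b}. \<not> (\<lambda>x. Re (F x)) differentiable (at x)} \<union>
      {x\<in>{a<..<b}. \<not> (\<lambda>x. Im (F x)) differentiable (at x)})"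
    proof (rule ccontr)
      assume neg: "\<not> ?thesis"
      then obtain p q where pq: "((\<lambda>x. Re (F x)) has_real_derivative p) (at x)" "((\<lambda>x. Im (F x)) has_real_derivative q) (at x)"
        using x by (auto simp: real_differentiable_def)
      then have "(F has_vector_derivative Complex p q) (at x)"
        by (simp add: has_vector_derivative_complex_iff)
      then show False using x vector_derivative_works differentiableI_vector by blast
    qed
  qed
qed

lemma sum_increment_tagged_division:
  assumes "a \<le> b" and p: "p tagged_division_of {a..b}"
  shows "(\<Sum>(x, K)\<in>p. increment F K) = F b - F a"
proof -
  have "(\<Sum>(x, K)\<in>p. increment F K) = (\<Sum>(x, K)\<in>p. F (Sup K) - F (Inf K))"
    using tagged_division_ofD(2)[OF p] by (intro sum.cong) (fastforce simp: increment_def)+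
  then show ?thesis
    using additive_tagged_division_1[OF assms, of F] by simp
qed

text \<open>In a sufficiently fine tagged division the cells with a tag outside the exceptional set \<open>N\<close> satisfy
  the usual straddle estimate. The cells tagged in \<open>N\<close> lie in an open set of small measure, so
  absolute continuity makes their increments small.\<close>

theorem abs_cont_fundamental_theorem:
  fixes F :: "real \<Rightarrow> 'a::banach"
  assumes F: "abs_cont F a b" and ab: "a \<le> b" and N: "negligible N"
    and der: "\<And>x. x \<in> {a..b} - N \<Longrightarrow> (F has_vector_derivative f x) (at x within {a..b})"
  shows "(f has_integral F b - F a) {a..b}"
proof (rule has_integral_spike[OF N])
  define f' where "f' x = (if x \<in> N then 0 else f x)" for x
  show "f x = f' x" if "x \<in> {a..b} - N" for x using that by (simp add: f'_def)
  show "(f' has_integral F b - F a) {a..b}"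
    unfolding has_integral_real
  proof (intro allI impI)
    fix e :: real assume e: "e > 0"
    define \<eta> where "\<eta> = e / (2 * (b - a + 1))"
    have \<eta>: "\<eta> > 0" "\<eta> * (b - a) < e / 2" using e ab by (auto simp: \<eta>_def field_simps)
    obtain \<delta> where \<delta>: "\<delta> > 0" "\<And>D. D division_of \<Union>D \<Longrightarrow> \<Union>D \<subseteq> {a..b} \<Longrightarrow> (\<Sum>K\<in>D. increment (\<lambda>x. x) K) < \<delta>
        \<Longrightarrow> (\<Sum>K\<in>D. norm (increment F K)) < e / 2"
      using F e unfolding abs_cont_def by (meson half_gt_zero)
    obtain U where U: "open U" "N \<subseteq> U" "U - N \<in> lmeasurable" "emeasure lebesgue (U - N) < ennreal \<delta>"
      using sets_lebesgue_outer_open[OF negligible_imp_sets[OF N] \<delta>(1)] .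
    have mU: "U \<in> lmeasurable" "measure lebesgue U < \<delta>"
    proof -
      have "U = (U - N) \<union> N" using U(2) by auto
      then show "U \<in> lmeasurable"
        using U(3) negligible_imp_measurable[OF N] fmeasurable.Un by metis
      have "measure lebesgue U \<le> measure lebesgue (U - N) + measure lebesgue N"
        using measure_Un_le[of "U - N" lebesgue N] \<open>U = (U - N) \<union> N\<close> U(3) negligible_imp_sets[OF N]
        by (metis fmeasurableD)
      also have "\<dots> = measure lebesgue (U - N)" using N negligible_imp_measure0 by simp
      also have "\<dots> < \<delta>"
        using U(3,4) \<delta>(1) by (simp add: emeasure_eq_measure2 ennreal_less_iff)
      finally show "measure lebesgue U < \<delta>" .
    qed
    have "\<exists>r>0. (x \<in> {a..b} \<longrightarrow> x \<notin> N \<longrightarrow> (\<forall>y\<in>{a..b}. norm (y - x) < r \<longrightarrow>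
          norm (F y - F x - (y - x) *\<^sub>R f x) \<le> \<eta> * norm (y - x))) \<and> (x \<in> N \<longrightarrow> ball x r \<subseteq> U)" for x
    proof (cases "x \<in> N")
      case True
      then show ?thesis using U openE by blast
    next
      case xN: False
      show ?thesis
      proof (cases "x \<in> {a..b}")
        case True
        then show ?thesis
          using der[of x] xN \<eta>(1) unfolding has_vector_derivative_def has_derivative_within_alt by blast
      qed (use xN in \<open>auto intro: exI[of _ 1]\<close>)
    qed
    then obtain r where r: "\<And>x. r x > 0"
      "\<And>x y. x \<in> {a..b} \<Longrightarrow> x \<notin> N \<Longrightarrow> y \<in> {a..b} \<Longrightarrow> norm (y - x) < r x \<Longrightarrow>
          norm (F y - F x - (y - x) *\<^sub>R f x) \<le> \<eta> * norm (y - x)"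
      "\<And>x. x \<in> N \<Longrightarrow> ball x (r x) \<subseteq> U"
      by metis
    show "\<exists>\<gamma>. gauge \<gamma> \<and> (\<forall>p. p tagged_division_of {a..b} \<and> \<gamma> fine p \<longrightarrow>
        norm ((\<Sum>(x, k)\<in>p. measure lborel k *\<^sub>R f' x) - (F b - F a)) < e)"
    proof (intro exI[of _ "\<lambda>x. ball x (r x)"] conjI allI impI)
      show "gauge (\<lambda>x. ball x (r x))" using r(1) gauge_ball_dependent by blast
      fix p assume "p tagged_division_of {a..b} \<and> (\<lambda>x. ball x (r x)) fine p"
      then have p: "p tagged_division_of {a..b}" and fine: "(\<lambda>x. ball x (r x)) fine p" by auto
      have finp: "finite p" using p by blast
      define pN where "pN = {(x, K)\<in>p. x \<in> N}"
      have pN: "pN tagged_partial_division_of {a..b}"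
        using tagged_partial_division_subset[of p "{a..b}" pN] p
        by (auto simp: pN_def tagged_division_of_def)
      have D: "(snd ` pN) division_of \<Union>(snd ` pN)"
        by (rule partial_division_of_tagged_division[OF pN])
      have cell: "\<exists>u v. u \<le> v \<and> K = {u..v} \<and> x \<in> K \<and> K \<subseteq> {a..b} \<and> K \<subseteq> ball x (r x)" if xK: "(x, K) \<in> p" for x K
      proof -
        have K: "x \<in> K" "K \<subseteq> {a..b}" using tagged_division_ofD(2,3)[OF p xK] by auto
        obtain u v where "K = cbox u v" using tagged_division_ofD(4)[OF p xK] by blast
        moreover have "K \<subseteq> ball x (r x)" using fineD[OF fine xK] .
        ultimately show ?thesis using K by (intro exI[of _ u] exI[of _ v]) auto
      qed
      have bad: "(\<Sum>(x, K)\<in>pN. norm (increment F K)) < e / 2"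
      proof -
        have "(\<Sum>(x, K)\<in>pN. norm (increment F K)) = (\<Sum>K\<in>snd ` pN. norm (increment F K))"
        proof (rule sum.over_tagged_division_lemma[OF tagged_partial_division_of_Union_self[OF pN]])
          fix u v :: real assume "box u v = {}"
          then show "norm (increment F (cbox u v)) = 0" by (simp add: increment_degenerate)
        qed
        also have "\<dots> < e / 2"
        proof (rule \<delta>(2)[OF D])
          show "\<Union>(snd ` pN) \<subseteq> {a..b}" using cell by (fastforce simp: pN_def)
          have "\<Union>(snd ` pN) \<subseteq> U"
          proof
            fix y assume "y \<in> \<Union>(snd ` pN)"
            then obtain x K where xK: "(x, K) \<in> p" "x \<in> N" "y \<in> K" by (auto simp: pN_def)
            then have "y \<in> ball x (r x)" using fineD[OF fine xK(1)] by blast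
            then show "y \<in> U" using r(3)[OF xK(2)] by blast
          qed
          moreover have "(\<Sum>K\<in>snd ` pN. increment (\<lambda>x. x) K) = measure lebesgue (\<Union>(snd ` pN))"
          proof -
            have "(\<Sum>K\<in>snd ` pN. increment (\<lambda>x. x) K) = (\<Sum>K\<in>snd ` pN. measure lebesgue K)"
            proof (rule sum.cong[OF refl])
              fix K assume "K \<in> snd ` pN"
              then obtain x where "(x, K) \<in> p" by (auto simp: pN_def)
              then obtain u v where "u \<le> v" "K = {u..v}" using cell by blast
              then show "increment (\<lambda>x. x) K = measure lebesgue K" by (simp add: increment_interval)
            qed
            then show ?thesis using content_division[OF D] by simp
          qed
          moreover have "\<Union>(snd ` pN) \<in> lmeasurable"
            using D lmeasurable_division by blast
          ultimately show "(\<Sum>K\<in>snd ` pN. increment (\<lambda>x. x) K) < \<delta>"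
            using mU measure_mono_fmeasurable[of "\<Union>(snd ` pN)" U lebesgue] by (auto simp: fmeasurableD)
        qed
        finally show ?thesis .
      qed
      have total: "(\<Sum>(x, K)\<in>p. increment F K) = F b - F a" "(\<Sum>(x, K)\<in>p. increment (\<lambda>x. x) K) = b - a"
        using sum_increment_tagged_division[OF ab p, of F] sum_increment_tagged_division[OF ab p, of "\<lambda>x. x"]
        by blast+
      have "norm (\<Sum>(x, K)\<in>p. measure lborel K *\<^sub>R f' x - increment F K)
          \<le> (\<Sum>(x, K)\<in>p. \<eta> * increment (\<lambda>x. x) K + (if x \<in> N then norm (increment F K) else 0))"
      proof (rule sum_norm_le, safe)
        fix x K assume xK: "(x, K) \<in> p"
        then obtain u v where K: "u \<le> v" "K = {u..v}" "x \<in> K" "K \<subseteq> {a..b}" "K \<subseteq> ball x (r x)"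
          using cell by blast
        show "norm (measure lborel K *\<^sub>R f' x - increment F K)
            \<le> \<eta> * increment (\<lambda>x. x) K + (if x \<in> N then norm (increment F K) else 0)"
        proof (cases "x \<in> N")
          case True
          have "0 \<le> \<eta> * (v - u)" using K(1) \<eta>(1) by simp
          then show ?thesis using True K(1,2) by (simp add: f'_def increment_interval norm_minus_commute[of "F u"])
        next
          case False
          have xab: "x \<in> {a..b}" "u \<in> {a..b}" "v \<in> {a..b}" "u \<in> ball x (r x)" "v \<in> ball x (r x)"
            using K(1,4) subsetD[OF K(5), of u] subsetD[OF K(5), of v] subsetD[OF K(4) K(3)] unfolding K(2) by auto
          have near: "norm (F y - F x - (y - x) *\<^sub>R f x) \<le> \<eta> * norm (y - x)" if "y \<in> {u, v}" for y
            using r(2)[OF xab(1) False, of y] xab that by (auto simp: dist_norm norm_minus_commute)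
          have "measure lborel K *\<^sub>R f' x - increment F K
              = (F u - F x - (u - x) *\<^sub>R f x) - (F v - F x - (v - x) *\<^sub>R f x)"
            using K False by (simp add: f'_def increment_interval algebra_simps)
          also have "norm \<dots> \<le> \<eta> * norm (u - x) + \<eta> * norm (v - x)"
            by (rule order_trans[OF norm_triangle_ineq4]) (intro add_mono near; simp)
          also have "\<dots> = \<eta> * increment (\<lambda>x. x) K"
            using K by (simp add: increment_interval algebra_simps)
          finally show ?thesis using False by simp
        qed
      qed
      also have "\<dots> = \<eta> * (\<Sum>(x, K)\<in>p. increment (\<lambda>x. x) K) + (\<Sum>(x, K)\<in>p. if x \<in> N then norm (increment F K) else 0)"
        by (simp only: split_def sum.distrib sum_distrib_left[symmetric])
      also have "(\<Sum>(x, K)\<in>p. if x \<in> N then norm (increment F K) else 0) = (\<Sum>(x, K)\<in>pN. norm (increment F K))"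
        using finp by (intro sum.mono_neutral_cong_right) (auto simp: pN_def split: if_splits)
      also have "\<eta> * (\<Sum>(x, K)\<in>p. increment (\<lambda>x. x) K) + (\<Sum>(x, K)\<in>pN. norm (increment F K)) < e / 2 + e / 2"
        using \<eta>(2) bad by (simp only: total add_strict_mono)
      finally have "norm (\<Sum>(x, K)\<in>p. measure lborel K *\<^sub>R f' x - increment F K) < e" by simp
      then show "norm ((\<Sum>(x, K)\<in>p. measure lborel K *\<^sub>R f' x) - (F b - F a)) < e"
        using total(1) by (simp add: split_def sum_subtractf)
    qed
  qed
qed

text \<open>The derivative is only asked for in the open interval, because the third derivative of a
  spline need not exist at the knots.\<close>

lemma abs_cont_bounded_derivative:
  fixes h :: "real \<Rightarrow> 'a::real_normed_vector"
  assumes cont: "continuous_on {a..b} h"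
    and der: "\<And>x. x \<in> {a<..<b} \<Longrightarrow> (h has_vector_derivative h' x) (at x)"
    and bound: "\<And>x. x \<in> {a<..<b} \<Longrightarrow> norm (h' x) \<le> M"
  shows "abs_cont h a b"
proof (rule abs_cont_lipschitz[where M = "max M 0"])
  fix u v assume uv: "a \<le> u" "u \<le> v" "v \<le> b"
  show "norm (h v - h u) \<le> max M 0 * (v - u)"
  proof (cases "u = v")
    case False
    have "norm (h v - h u) \<le> max M 0 * v - max M 0 * u"
    proof (rule differentiable_bound_general[where f' = h' and \<phi>' = "\<lambda>_. max M 0"])
      show "continuous_on {u..v} h" using cont uv by (auto intro: continuous_on_subset)
      show "((*) (max M 0) has_vector_derivative max M 0) (at x)" for x
        by (auto intro!: derivative_eq_intros simp: has_real_derivative_iff_has_vector_derivative[symmetric])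
      fix x assume "u < x" "x < v"
      then have "x \<in> {a<..<b}" using uv by auto
      then show "(h has_vector_derivative h' x) (at x)" "norm (h' x) \<le> max M 0"
        using der bound[of x] by auto
    qed (use uv False in \<open>auto intro!: continuous_intros\<close>)
    then show ?thesis by (simp add: algebra_simps)
  qed simp
qed simp

section \<open>Functions of finite energy\<close>

lemma nth_deriv_simps:
  "nth_deriv 0 g = g"
  "nth_deriv (Suc k) g r = vector_derivative (nth_deriv k g) (at r)"
  by (simp_all add: nth_deriv_def)

context
  fixes f :: "real \<Rightarrow> complex"
  assumes f: "f \<in> Lambda0"
begin

lemma Lambda0_deriv:
  assumes "r > 0" shows "(f has_vector_derivative nth_deriv 1 f r) (at r)"
proof -
  have "f differentiable (at r)"
    using f assms by (auto simp: Lambda0_def C1_differentiable_on_eq)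
  then show ?thesis
    by (simp add: nth_deriv_simps vector_derivative_works)
qed

lemma Lambda0_deriv_continuous: "continuous_on {0<..} (nth_deriv 1 f)"
proof -
  have "continuous_on {0<..} (\<lambda>x. vector_derivative f (at x))"
    using f by (auto simp: Lambda0_def C1_differentiable_on_eq)
  then show ?thesis by (simp add: nth_deriv_simps[abs_def] cong: continuous_on_cong)
qed

lemma Lambda0_abs_cont:
  assumes "0 < a" "a < b" shows "abs_cont (nth_deriv 1 f) a b"
  using f assms by (auto simp: Lambda0_def abs_cont_iff)

lemma energy_density_nonneg: "r > 0 \<Longrightarrow> 0 \<le> energy_density g r"
  by (simp add: energy_density_def)

lemma Lambda0_energy:
  shows "energy_density f integrable_on {0<..}" "(norm0 f)\<^sup>2 = integral {0<..} (energy_density f)"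
    "0 \<le> norm0 f"
proof -
  have int: "set_integrable lebesgue {0<..} (energy_density f)" using f by (simp add: Lambda0_def)
  show *: "energy_density f integrable_on {0<..}" using set_lebesgue_integral_eq_integral[OF int] by simp
  have "0 \<le> integral {0<..} (energy_density f)"
    using energy_density_nonneg by (intro integral_nonneg *) auto
  then show "(norm0 f)\<^sup>2 = integral {0<..} (energy_density f)" "0 \<le> norm0 f"
    using set_lebesgue_integral_eq_integral[OF int] by (simp_all add: norm0_def)
qed

lemma Lambda0_energy_interval:
  assumes "0 < a"
  shows "energy_density f integrable_on {a..b}" "integral {a..b} (energy_density f) \<le> (norm0 f)\<^sup>2"
proof -
  have int: "set_integrable lebesgue {0<..} (energy_density f)" using f by (simp add: Lambda0_def)
  have "set_integrable lebesgue {a..b} (energy_density f)"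
    by (rule set_integrable_subset[OF int]) (use assms in auto)
  then show *: "energy_density f integrable_on {a..b}" by (rule set_lebesgue_integral_eq_integral)
  show "integral {a..b} (energy_density f) \<le> (norm0 f)\<^sup>2"
    unfolding Lambda0_energy(2) using assms energy_density_nonneg
    by (intro integral_subset_le * Lambda0_energy(1)) auto
qed

text \<open>A lower bound on \<open>\<bar>f'\<bar>\<close> costs energy in proportion to the logarithmic length of the interval. As
  this length is infinite at 0 and at infinity, \<open>f'\<close> takes arbitrarily small values near both ends.\<close>

lemma Lambda0_log_bound:
  assumes "0 < a" "a \<le> b" "\<eta> > 0" and big: "\<And>r. r \<in> {a..b} \<Longrightarrow> norm (nth_deriv 1 f r) \<ge> \<eta>"
  shows "\<eta>\<^sup>2 * (ln b - ln a) \<le> (norm0 f)\<^sup>2"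
proof -
  have "((\<lambda>r. \<eta>\<^sup>2 * (1 / r)) has_integral (\<eta>\<^sup>2 * (ln b - ln a))) {a..b}"
    using assms(1,2)
    by (intro has_integral_mult_right fundamental_theorem_of_calculus)
      (auto intro!: derivative_eq_intros simp: has_real_derivative_iff_has_vector_derivative[symmetric])
  then have "\<eta>\<^sup>2 * (ln b - ln a) \<le> integral {a..b} (energy_density f)"
  proof (rule has_integral_le[OF _ integrable_integral[OF Lambda0_energy_interval(1)[OF assms(1)]]])
    fix r assume r: "r \<in> {a..b}"
    have "\<eta>\<^sup>2 \<le> (norm (nth_deriv 1 f r))\<^sup>2"
      using big[OF r] assms(3) by (intro power_mono) auto
    then have "\<eta>\<^sup>2 * (1 / r) \<le> (norm (nth_deriv 1 f r))\<^sup>2 * (1 / r)"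
      using r assms(1) by (intro mult_right_mono) auto
    also have "\<dots> \<le> energy_density f r"
      using r assms(1) by (simp add: energy_density_def)
    finally show "\<eta>\<^sup>2 * (1 / r) \<le> energy_density f r" .
  qed
  then show ?thesis using Lambda0_energy_interval(2)[OF assms(1), of b] by linarith
qed

lemma Lambda0_deriv_small_near_0:
  assumes "\<eta> > 0" "b > 0"
  shows "\<exists>r. 0 < r \<and> r < b \<and> norm (nth_deriv 1 f r) < \<eta>"
proof (rule ccontr)
  assume neg: "\<not> ?thesis"
  define c where "c = b / 2"
  \<comment> \<open>\<open>[a, c]\<close> is just too long, logarithmically, for the available energy.\<close>
  define a where "a = c * exp (- ((norm0 f)\<^sup>2 / \<eta>\<^sup>2 + 1))"
  have c: "0 < c" "c < b" using assms by (auto simp: c_def)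
  have a: "0 < a" "a \<le> c"
  proof -
    show "0 < a" using c by (simp add: a_def)
    have "0 \<le> (norm0 f)\<^sup>2 / \<eta>\<^sup>2" by simp
    then have "- ((norm0 f)\<^sup>2 / \<eta>\<^sup>2 + 1) \<le> 0" by linarith
    then have "exp (- ((norm0 f)\<^sup>2 / \<eta>\<^sup>2 + 1)) \<le> 1" by (simp only: exp_le_one_iff)
    then show "a \<le> c" using c mult_left_mono[of _ 1 c] by (simp add: a_def)
  qed
  have "\<eta>\<^sup>2 * (ln c - ln a) \<le> (norm0 f)\<^sup>2"
  proof (intro Lambda0_log_bound assms c a)
    fix r assume "r \<in> {a..c}"
    then have "0 < r" "r < b" using c a by auto
    then show "\<eta> \<le> norm (nth_deriv 1 f r)" using neg by (meson not_less)
  qed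
  moreover have "ln c - ln a = (norm0 f)\<^sup>2 / \<eta>\<^sup>2 + 1" using c by (simp add: a_def ln_mult)
  ultimately show False using assms by (simp add: field_simps)
qed

lemma Lambda0_deriv_small_near_infinity:
  assumes "\<eta> > 0" "a > 0"
  shows "\<exists>r. a < r \<and> norm (nth_deriv 1 f r) < \<eta>"
proof (rule ccontr)
  assume neg: "\<not> ?thesis"
  define c where "c = 2 * a"
  \<comment> \<open>As before, \<open>[c, b]\<close> is just too long for the available energy.\<close>
  define b where "b = c * exp ((norm0 f)\<^sup>2 / \<eta>\<^sup>2 + 1)"
  have c: "0 < c" "a < c" using assms by (auto simp: c_def)
  have b: "c \<le> b"
  proof -
    have "1 \<le> exp ((norm0 f)\<^sup>2 / \<eta>\<^sup>2 + 1)"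
      using divide_nonneg_nonneg[of "(norm0 f)\<^sup>2" "\<eta>\<^sup>2"] by simp
    then show "c \<le> b" using c mult_left_mono[of 1 _ c] by (simp add: b_def)
  qed
  have "\<eta>\<^sup>2 * (ln b - ln c) \<le> (norm0 f)\<^sup>2"
  proof (intro Lambda0_log_bound assms c b)
    fix r assume "r \<in> {c..b}"
    then have "a < r" using c by simp
    then show "\<eta> \<le> norm (nth_deriv 1 f r)" using neg by (meson not_less)
  qed
  moreover have "ln b - ln c = (norm0 f)\<^sup>2 / \<eta>\<^sup>2 + 1" using c by (simp add: b_def ln_mult)
  ultimately show False using assms by (simp add: field_simps)
qed

text \<open>Near 0 the derivative is integrable, since \<open>\<bar>f'\<bar> \<le> \<bar>f'\<bar>\<^sup>2 / r + 1\<close> on \<open>(0, 1]\<close>; so the integral of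
  \<open>f'\<close> over \<open>[r, 1]\<close> converges. Thus the limit in \<^const>\<open>value_at_0\<close> exists.\<close>

lemma Lambda0_tendsto_value_at_0: "(f \<longlongrightarrow> value_at_0 f) (at_right 0)"
proof -
  have "nth_deriv 1 f integrable_on {0<..1}"
  proof (rule measurable_bounded_by_integrable_imp_integrable)
    show "nth_deriv 1 f \<in> borel_measurable (lebesgue_on {0<..1})"
      by (rule continuous_imp_measurable_on_sets_lebesgue[OF continuous_on_subset[OF Lambda0_deriv_continuous]])
        auto
    have int: "set_integrable lebesgue {0<..} (energy_density f)" using f by (simp add: Lambda0_def)
    have "set_integrable lebesgue {0<..1} (energy_density f)"
      by (rule set_integrable_subset[OF int]) auto
    then have "energy_density f integrable_on {0<..1}" by (rule set_lebesgue_integral_eq_integral)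
    moreover have "(\<lambda>r::real. 1::real) integrable_on {0<..1}"
      by (rule integrable_spike_set[where S = "{0..1}", OF integrable_const_ivl])
        (auto intro: negligible_subset[of "{0}"])
    ultimately show "(\<lambda>r. energy_density f r + 1) integrable_on {0<..1}"
      by (rule integrable_add)
    fix r :: real assume r: "r \<in> {0<..1}"
    have "norm (nth_deriv 1 f r) \<le> (norm (nth_deriv 1 f r))\<^sup>2 + 1"
      using zero_le_power2[of "norm (nth_deriv 1 f r) - 1 / 2"]
      by (simp add: power2_eq_square algebra_simps)
    also have "(norm (nth_deriv 1 f r))\<^sup>2 \<le> 1 / r * (norm (nth_deriv 1 f r))\<^sup>2"
      using r mult_right_mono[of 1 "1 / r" "(norm (nth_deriv 1 f r))\<^sup>2"] by simp
    also have "\<dots> \<le> energy_density f r" using r by (simp add: energy_density_def)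
    finally show "norm (nth_deriv 1 f r) \<le> energy_density f r + 1" by simp
  qed auto
  then have int: "nth_deriv 1 f integrable_on {0..1}"
    by (rule integrable_spike_set) (auto intro: negligible_subset[of "{0}"])
  define I where "I r = integral {r..1} (nth_deriv 1 f)" for r
  have "continuous_on {0..1} I"
    unfolding I_def by (rule indefinite_integral_continuous_1'[OF int])
  then have "(I \<longlongrightarrow> I 0) (at 0 within {0..1})"
    by (simp add: continuous_on)
  then have "(I \<longlongrightarrow> I 0) (at_right 0)"
    by (simp add: at_within_Icc_at_right)
  then have lim: "((\<lambda>r. f 1 - I r) \<longlongrightarrow> f 1 - I 0) (at_right 0)"
    by (intro tendsto_intros)
  have "f 1 - I r = f r" if "0 < r" "r < 1" for r
  proof -
    have "(nth_deriv 1 f has_integral f 1 - f r) {r..1}"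
    proof (rule fundamental_theorem_of_calculus)
      fix x assume "x \<in> {r..1}"
      then show "(f has_vector_derivative nth_deriv 1 f x) (at x within {r..1})"
        using Lambda0_deriv[of x] that by (simp add: has_vector_derivative_at_within)
    qed (use that in simp)
    then show ?thesis by (simp add: I_def integral_unique)
  qed
  then have "\<forall>\<^sub>F r in at_right 0. f 1 - I r = f r"
    using eventually_at_right_real[of 0 1] by (auto elim: eventually_mono)
  then have "(f \<longlongrightarrow> f 1 - I 0) (at_right 0)"
    using lim by (rule Lim_transform_eventually[rotated])
  then show ?thesis
    unfolding value_at_0_def by (metis tendsto_Lim trivial_limit_at_right_real)
qed

end

section \<open>The differential equations of the spline pieces\<close>

lemma times_differentiable_onD:
  assumes "times_differentiable_on m g S" "k < m" "r \<in> S"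
  shows "(nth_deriv k g has_vector_derivative nth_deriv (Suc k) g r) (at r)"
  using assms unfolding times_differentiable_on_def nth_deriv_simps(2)
  by (metis vector_derivative_works)

lemma has_vector_derivative_divide_id:
  fixes g :: "real \<Rightarrow> complex"
  assumes "(g has_vector_derivative g') (at r)" "r \<noteq> 0"
  shows "((\<lambda>x. (1 / x) *\<^sub>R g x) has_vector_derivative (1 / r) *\<^sub>R g' - (1 / r\<^sup>2) *\<^sub>R g r) (at r)"
proof -
  have "((\<lambda>x. 1 / x) has_real_derivative - (1 / r\<^sup>2)) (at r)"
    using assms(2) by (auto intro!: derivative_eq_intros simp: power2_eq_square)
  then show ?thesis
    using has_vector_derivative_scaleR[OF _ assms(1)] by fastforce
qed

text \<open>The first integral of \<open>L\<^sub>0 \<eta> = 0\<close>: with \<open>w = \<eta>' / r - (r \<eta>'')'\<close> one has \<open>w' = - L\<^sub>0 \<eta>\<close>, so \<open>w\<close> is a constant \<open>c\<close>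
  on each piece. On the outer pieces the equations with \<open>G\<^sub>0\<close> and \<open>R\<^sub>0\<close> imply the same law, although they
  involve fewer derivatives.\<close>

definition flux_law :: "(real \<Rightarrow> complex) \<Rightarrow> complex \<Rightarrow> real set \<Rightarrow> bool" where
  "flux_law \<eta> c S \<longleftrightarrow> (\<forall>r\<in>S. ((\<lambda>x. x *\<^sub>R nth_deriv 2 \<eta> x) has_vector_derivative
     (1 / r) *\<^sub>R nth_deriv 1 \<eta> r - c) (at r))"

lemma moment_derivative:
  fixes s2 :: "real \<Rightarrow> complex"
  assumes "(s2 has_vector_derivative s3) (at r)"
  shows "((\<lambda>x. x *\<^sub>R s2 x) has_vector_derivative s2 r + r *\<^sub>R s3) (at r)"
proof -
  have "((\<lambda>x. x) has_real_derivative 1) (at r)" by simp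
  from has_vector_derivative_scaleR[OF this assms] show ?thesis by (simp add: add.commute)
qed

lemma flux_law_inner:
  assumes "times_differentiable_on 4 \<eta> {p<..<q}" "\<And>r. r \<in> {p<..<q} \<Longrightarrow> op_L0 \<eta> r = 0" "0 < p"
  obtains c where "flux_law \<eta> c {p<..<q}"
proof -
  define s1 s2 s3 s4 where "s1 = nth_deriv 1 \<eta>" and "s2 = nth_deriv 2 \<eta>" and "s3 = nth_deriv 3 \<eta>" and "s4 = nth_deriv 4 \<eta>"
  have d1: "(s1 has_vector_derivative s2 r) (at r)" and d2: "(s2 has_vector_derivative s3 r) (at r)"
    and d3: "(s3 has_vector_derivative s4 r) (at r)" if "r \<in> {p<..<q}" for r
    using times_differentiable_onD[OF assms(1) _ that, of 1] times_differentiable_onD[OF assms(1) _ that, of 2]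
      times_differentiable_onD[OF assms(1) _ that, of 3]
    by (simp_all add: s1_def s2_def s3_def s4_def eval_nat_numeral)
  define w where "w r = (1 / r) *\<^sub>R s1 r - (s2 r + r *\<^sub>R s3 r)" for r
  have "(w has_vector_derivative 0) (at r within {p<..<q})" if r: "r \<in> {p<..<q}" for r
  proof -
    have r0: "r > 0" using r assms(3) by auto
    have eq: "r *\<^sub>R s4 r + 2 *\<^sub>R s3 r - (1 / r) *\<^sub>R s2 r + (1 / r\<^sup>2) *\<^sub>R s1 r = 0"
      using assms(2)[OF r] by (simp add: op_L0_def s1_def s2_def s3_def s4_def scaleR_conv_of_real)
    have "(w has_vector_derivative ((1 / r) *\<^sub>R s2 r - (1 / r\<^sup>2) *\<^sub>R s1 r) - (s3 r + (s3 r + r *\<^sub>R s4 r))) (at r)"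
      unfolding w_def[abs_def] using r0
      by (intro has_vector_derivative_diff has_vector_derivative_add has_vector_derivative_divide_id
          moment_derivative d1 d2 d3 r) auto
    moreover have "((1 / r) *\<^sub>R s2 r - (1 / r\<^sup>2) *\<^sub>R s1 r) - (s3 r + (s3 r + r *\<^sub>R s4 r))
        = - (r *\<^sub>R s4 r + 2 *\<^sub>R s3 r - (1 / r) *\<^sub>R s2 r + (1 / r\<^sup>2) *\<^sub>R s1 r)"
      by (simp add: scaleR_2)
    ultimately show ?thesis using eq by (simp add: has_vector_derivative_at_within)
  qed
  then obtain c where c: "\<And>r. r \<in> {p<..<q} \<Longrightarrow> w r = c"
    using has_vector_derivative_zero_constant[of "{p<..<q}" w] by blast
  show thesis
  proof (rule that, unfold flux_law_def, intro ballI)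
    fix r assume r: "r \<in> {p<..<q}"
    show "((\<lambda>x. x *\<^sub>R nth_deriv 2 \<eta> x) has_vector_derivative (1 / r) *\<^sub>R nth_deriv 1 \<eta> r - c) (at r)"
      using moment_derivative[OF d2[OF r]] c[OF r] by (simp add: w_def s1_def s2_def algebra_simps)
  qed
qed

text \<open>Here \<open>G\<^sub>0 \<eta> = 0\<close> expresses the third derivative by lower ones and turns \<open>w\<close> into
  \<open>2 (\<eta>' / r - \<eta>'')\<close>, whose derivative is \<open>- 2 G\<^sub>0 \<eta>\<close>. This is the reason for the factor \<open>1 / 2\<close> in front of \<open>c\<close>.\<close>

lemma flux_law_first:
  assumes "times_differentiable_on 3 \<eta> {0<..<q}" "\<And>r. r \<in> {0<..<q} \<Longrightarrow> op_G0 \<eta> r = 0"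
  obtains c where "flux_law \<eta> c {0<..<q}"
    "\<And>r. r \<in> {0<..<q} \<Longrightarrow> nth_deriv 2 \<eta> r = (1 / r) *\<^sub>R nth_deriv 1 \<eta> r - c /\<^sub>R 2"
proof -
  define s1 s2 s3 where "s1 = nth_deriv 1 \<eta>" and "s2 = nth_deriv 2 \<eta>" and "s3 = nth_deriv 3 \<eta>"
  have d1: "(s1 has_vector_derivative s2 r) (at r)" and d2: "(s2 has_vector_derivative s3 r) (at r)"
    if "r \<in> {0<..<q}" for r
    using times_differentiable_onD[OF assms(1) _ that, of 1] times_differentiable_onD[OF assms(1) _ that, of 2]
    by (simp_all add: s1_def s2_def s3_def eval_nat_numeral)
  have eq: "s3 r = (1 / r) *\<^sub>R s2 r - (1 / r\<^sup>2) *\<^sub>R s1 r" if r: "r \<in> {0<..<q}" for r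
    using assms(2)[OF r] by (simp add: op_G0_def s1_def s2_def s3_def scaleR_conv_of_real algebra_simps)
  define w where "w r = (1 / r) *\<^sub>R s1 r - s2 r" for r
  have "(w has_vector_derivative 0) (at r within {0<..<q})" if r: "r \<in> {0<..<q}" for r
  proof -
    have "(w has_vector_derivative ((1 / r) *\<^sub>R s2 r - (1 / r\<^sup>2) *\<^sub>R s1 r) - s3 r) (at r)"
      unfolding w_def[abs_def] using r
      by (intro has_vector_derivative_diff has_vector_derivative_divide_id d1 d2) auto
    then show ?thesis using eq[OF r] by (simp add: has_vector_derivative_at_within)
  qed
  then obtain k where k: "\<And>r. r \<in> {0<..<q} \<Longrightarrow> w r = k"
    using has_vector_derivative_zero_constant[of "{0<..<q}" w] by blast
  show thesis
  proof (rule that[of "2 *\<^sub>R k"])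
    show s2: "nth_deriv 2 \<eta> r = (1 / r) *\<^sub>R nth_deriv 1 \<eta> r - (2 *\<^sub>R k) /\<^sub>R 2" if "r \<in> {0<..<q}" for r
      using k[OF that] by (simp add: w_def s1_def s2_def algebra_simps)
    show "flux_law \<eta> (2 *\<^sub>R k) {0<..<q}"
      unfolding flux_law_def
    proof
      fix r assume r: "r \<in> {0<..<q}"
      have "r *\<^sub>R s3 r = s2 r - (1 / r) *\<^sub>R s1 r"
        using eq[OF r] r by (simp add: scaleR_diff_right power2_eq_square)
      then have "s2 r + r *\<^sub>R s3 r = (1 / r) *\<^sub>R s1 r - 2 *\<^sub>R k"
        using k[OF r] by (simp add: w_def scaleR_2 algebra_simps)
      then show "((\<lambda>x. x *\<^sub>R nth_deriv 2 \<eta> x) has_vector_derivative (1 / r) *\<^sub>R nth_deriv 1 \<eta> r - 2 *\<^sub>R k) (at r)"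
        using moment_derivative[OF d2[OF r]] by (simp add: s1_def s2_def)
    qed
  qed
qed

text \<open>\<open>R\<^sub>0 \<eta> = 0\<close> says \<open>(r \<eta>')' = 0\<close>, so \<open>r \<eta>'\<close> is a constant \<open>\<beta>\<close>, and \<open>r \<eta>'' = - \<eta>'\<close>.\<close>

lemma flux_law_last:
  assumes "times_differentiable_on 2 \<eta> {p<..}" "\<And>r. r \<in> {p<..} \<Longrightarrow> op_R0 \<eta> r = 0" "0 \<le> p"
  obtains \<beta> where "flux_law \<eta> 0 {p<..}" "\<And>r. r > p \<Longrightarrow> nth_deriv 1 \<eta> r = (1 / r) *\<^sub>R \<beta>"
    "\<And>r. r > p \<Longrightarrow> nth_deriv 2 \<eta> r = - ((1 / r) *\<^sub>R nth_deriv 1 \<eta> r)"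
proof -
  define s1 s2 where "s1 = nth_deriv 1 \<eta>" and "s2 = nth_deriv 2 \<eta>"
  have d1: "(s1 has_vector_derivative s2 r) (at r)" if "r > p" for r
    using times_differentiable_onD[OF assms(1), of 1] that
    by (simp add: s1_def s2_def eval_nat_numeral)
  have eq: "s2 r = - ((1 / r) *\<^sub>R s1 r)" if r: "r > p" for r
  proof -
    have "s2 r + (1 / r) *\<^sub>R s1 r = 0"
      using assms(2)[of r] assms(3) r by (simp add: op_R0_def s1_def s2_def scaleR_conv_of_real)
    then show ?thesis by (rule eq_neg_iff_add_eq_0[THEN iffD2])
  qed
  have "((\<lambda>x. x *\<^sub>R s1 x) has_vector_derivative 0) (at r within {p<..})" if r: "r \<in> {p<..}" for r
  proof -
    have "((\<lambda>x. x *\<^sub>R s1 x) has_vector_derivative s1 r + r *\<^sub>R s2 r) (at r)"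
      using r by (intro moment_derivative d1) auto
    then show ?thesis using eq[of r] r assms(3) by (simp add: has_vector_derivative_at_within)
  qed
  then obtain \<beta> where \<beta>: "\<And>r. r \<in> {p<..} \<Longrightarrow> r *\<^sub>R s1 r = \<beta>"
    using has_vector_derivative_zero_constant[of "{p<..}" "\<lambda>x. x *\<^sub>R s1 x"] by blast
  show thesis
  proof (rule that)
    show "nth_deriv 2 \<eta> r = - ((1 / r) *\<^sub>R nth_deriv 1 \<eta> r)" if "r > p" for r
      using eq[OF that] by (simp add: s1_def s2_def)
    show "nth_deriv 1 \<eta> r = (1 / r) *\<^sub>R \<beta>" if "r > p" for r
      using \<beta>[of r] that assms(3) by (auto simp: s1_def)
    show "flux_law \<eta> 0 {p<..}"
      unfolding flux_law_def
    proof
      fix r assume r: "r \<in> {p<..}"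
      have "((\<lambda>x. - s1 x) has_vector_derivative - s2 r) (at r)"
        using r by (intro has_vector_derivative_minus d1) auto
      then have "((\<lambda>x. x *\<^sub>R s2 x) has_vector_derivative - s2 r) (at r)"
      proof (rule has_vector_derivative_transform_within_open[of _ _ _ "{p<..}"])
        fix x assume "x \<in> {p<..}"
        then show "- s1 x = x *\<^sub>R s2 x" using eq[of x] assms(3) by simp
      qed (use r in auto)
      then show "((\<lambda>x. x *\<^sub>R nth_deriv 2 \<eta> x) has_vector_derivative (1 / r) *\<^sub>R nth_deriv 1 \<eta> r - 0) (at r)"
        using eq[of r] r by (simp add: s1_def s2_def)
    qed
  qed
qed

text \<open>The equation integrates to \<open>s\<^sub>1 = C r - k r ln r\<close>.\<close>

lemma first_piece_deriv_tendsto_0: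
  assumes q: "q > 0" and d: "\<And>r. r \<in> {0<..<q} \<Longrightarrow> (s1 has_vector_derivative s2 r) (at r)"
    and eq: "\<And>r. r \<in> {0<..<q} \<Longrightarrow> s2 r = (1 / r) *\<^sub>R s1 r - (k :: complex)"
  shows "(s1 \<longlongrightarrow> 0) (at_right 0)"
proof -
  have "((\<lambda>x. (1 / x) *\<^sub>R s1 x + ln x *\<^sub>R k) has_vector_derivative 0) (at r within {0<..<q})"
    if r: "r \<in> {0<..<q}" for r
  proof -
    have "((\<lambda>x. ln x *\<^sub>R k) has_vector_derivative (1 / r) *\<^sub>R k) (at r)"
      using r by (auto intro!: derivative_eq_intros has_vector_derivative_scaleR
          simp: has_real_derivative_iff_has_vector_derivative[symmetric] divide_inverse)
    from has_vector_derivative_add[OF has_vector_derivative_divide_id[OF d[OF r]] this]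
    show ?thesis
      using r eq[OF r] by (simp add: has_vector_derivative_at_within scaleR_diff_right power2_eq_square)
  qed
  then obtain C where C: "\<And>r. r \<in> {0<..<q} \<Longrightarrow> (1 / r) *\<^sub>R s1 r + ln r *\<^sub>R k = C"
    using has_vector_derivative_zero_constant[of "{0<..<q}" "\<lambda>x. (1 / x) *\<^sub>R s1 x + ln x *\<^sub>R k"] by blast
  have s1: "s1 r = r *\<^sub>R C - (r * ln r) *\<^sub>R k" if r: "r \<in> {0<..<q}" for r
  proof -
    have "r *\<^sub>R ((1 / r) *\<^sub>R s1 r + ln r *\<^sub>R k) = r *\<^sub>R C" using C[OF r] by simp
    then show ?thesis using r by (simp add: scaleR_add_right algebra_simps)
  qed
  have "((\<lambda>r. ln (inverse r) / inverse r) \<longlongrightarrow> (0::real)) (at_right 0)"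
    using filterlim_compose[OF ln_x_over_x_tendsto_0 filterlim_inverse_at_top_right] .
  then have "((\<lambda>r. - (ln (inverse r) / inverse r)) \<longlongrightarrow> (- 0 :: real)) (at_right 0)"
    by (rule tendsto_minus)
  then have "((\<lambda>r. r * ln r) \<longlongrightarrow> (0::real)) (at_right 0)"
    by (rule Lim_transform_eventually[THEN tendsto_eq_rhs])
      (auto intro!: eventually_mono[OF eventually_at_right_less] simp: ln_inverse divide_inverse)
  then have "((\<lambda>r. r *\<^sub>R C - (r * ln r) *\<^sub>R k) \<longlongrightarrow> 0 *\<^sub>R C - 0 *\<^sub>R k) (at_right 0)"
    by (intro tendsto_intros)
  then have "((\<lambda>r. r *\<^sub>R C - (r * ln r) *\<^sub>R k) \<longlongrightarrow> 0) (at_right 0)" by simp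
  moreover have "\<forall>\<^sub>F r in at_right 0. r *\<^sub>R C - (r * ln r) *\<^sub>R k = s1 r"
    using eventually_at_right_real[OF q] by eventually_elim (simp add: s1)
  ultimately show ?thesis by (rule Lim_transform_eventually)
qed

text \<open>For \<open>a r\<^sup>2 + b\<close> both \<open>\<eta>''\<close> and \<open>\<eta>' / r\<close> are equal to \<open>2 a\<close>.\<close>

lemma non_singular_flux_zero:
  assumes q: "q > 0" and quad: "\<And>r. r \<in> {0<..<q} \<Longrightarrow> \<eta> r = a * of_real (r\<^sup>2) + b"
    and c: "\<And>r. r \<in> {0<..<q} \<Longrightarrow> nth_deriv 2 \<eta> r = (1 / r) *\<^sub>R nth_deriv 1 \<eta> r - c /\<^sub>R 2"
  shows "c = 0"
proof -
  have d1: "nth_deriv 1 \<eta> r = 2 * a * of_real r" if r: "r \<in> {0<..<q}" for r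
  proof -
    have "((\<lambda>r. a * of_real (r\<^sup>2) + b) has_vector_derivative 2 * a * of_real r) (at r)"
      by (auto intro!: derivative_eq_intros has_vector_derivative_real_field)
    then have "(\<eta> has_vector_derivative 2 * a * of_real r) (at r)"
      by (rule has_vector_derivative_transform_within_open[of _ _ _ "{0<..<q}"]) (use r quad in auto)
    then show ?thesis by (simp add: nth_deriv_simps vector_derivative_at)
  qed
  have d2: "nth_deriv 2 \<eta> r = 2 * a" if r: "r \<in> {0<..<q}" for r
  proof -
    have "((\<lambda>r. 2 * a * of_real r) has_vector_derivative 2 * a) (at r)"
      by (auto intro!: derivative_eq_intros has_vector_derivative_real_field)
    then have "(nth_deriv 1 \<eta> has_vector_derivative 2 * a) (at r)"
      by (rule has_vector_derivative_transform_within_open[of _ _ _ "{0<..<q}"]) (use r d1 in auto)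
    then show ?thesis by (simp add: numeral_2_eq_2 nth_deriv_simps vector_derivative_at)
  qed
  have "q / 2 \<in> {0<..<q}" using q by simp
  have "(1 / (q / 2)) *\<^sub>R nth_deriv 1 \<eta> (q / 2) = 2 * a"
    unfolding d1[OF \<open>q / 2 \<in> {0<..<q}\<close>] using q by (simp add: scaleR_conv_of_real)
  then have "2 * a = 2 * a - c /\<^sub>R 2"
    using c[OF \<open>q / 2 \<in> {0<..<q}\<close>] d2[OF \<open>q / 2 \<in> {0<..<q}\<close>] by metis
  then show ?thesis by simp
qed

lemma knots_mono:
  assumes "knots n \<rho>" "1 \<le> j" "j < k" "k \<le> n"
  shows "\<rho> j < \<rho> k"
  using assms by (auto simp: knots_def strict_mono_on_def)

lemma knots_mono_le:
  assumes "knots n \<rho>" "1 \<le> j" "j \<le> k" "k \<le> n"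
  shows "\<rho> j \<le> \<rho> k"
  using knots_mono[OF assms(1,2) _ assms(4)] assms(3) by (cases "j = k") (auto simp: less_imp_le)

lemma knots_pos:
  assumes "knots n \<rho>" "1 \<le> j" "j \<le> n"
  shows "0 < \<rho> j"
  using knots_mono_le[OF assms(1) _ assms(2,3)] assms(1) by (simp add: knots_def)

lemma knots_cover:
  fixes \<rho> :: "nat \<Rightarrow> real"
  assumes "1 \<le> n"
  obtains "r < \<rho> 1" | "r > \<rho> n" | j where "j \<in> {1..n}" "r = \<rho> j"
    | j where "j \<in> {1..n - 1}" "r \<in> {\<rho> j<..<\<rho> (Suc j)}"
proof -
  have "r < \<rho> 1 \<or> r > \<rho> n \<or> (\<exists>j\<in>{1..n}. r = \<rho> j) \<or> (\<exists>j\<in>{1..n - 1}. r \<in> {\<rho> j<..<\<rho> (Suc j)})"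
    using assms
  proof (induction n rule: dec_induct)
    case base
    then show ?case by (metis atLeastAtMost_singleton insertI1 linorder_neqE)
  next
    case (step m)
    consider "r < \<rho> 1" | "r > \<rho> m" | j where "j \<in> {1..m}" "r = \<rho> j"
      | j where "j \<in> {1..m - 1}" "r \<in> {\<rho> j<..<\<rho> (Suc j)}"
      using step.IH by blast
    then show ?case
    proof cases
      case 2
      then consider "r \<in> {\<rho> m<..<\<rho> (Suc m)}" | "r = \<rho> (Suc m)" | "r > \<rho> (Suc m)" by fastforce
      then show ?thesis
      proof cases
        case 1
        then show ?thesis using step.hyps by (intro disjI2 bexI[of _ m]) auto
      qed auto
    next
      case 3
      then show ?thesis by (intro disjI2 disjI1 bexI[of _ j]) auto
    next
      case 4
      then show ?thesis by (intro disjI2 bexI[of _ j]) auto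
    qed auto
  qed
  then show thesis using that by blast
qed

text \<open>Splines are \<open>C\<^sup>2\<close> on the whole open half-line. Beyond the last knot only two derivatives are given,
  and continuity of the second one comes from the equation \<open>\<eta>'' = - \<eta>' / r\<close>.\<close>

lemma S0_regularity:
  assumes n: "n \<ge> 1" and \<rho>: "knots n \<rho>" and \<eta>: "\<eta> \<in> S0 n \<rho>" and r: "r > 0"
  shows "(\<eta> has_vector_derivative nth_deriv 1 \<eta> r) (at r)"
    "(nth_deriv 1 \<eta> has_vector_derivative nth_deriv 2 \<eta> r) (at r)"
    "isCont (nth_deriv 2 \<eta>) r"
proof -
  have "(\<eta> has_vector_derivative nth_deriv 1 \<eta> r) (at r) \<and>
    (nth_deriv 1 \<eta> has_vector_derivative nth_deriv 2 \<eta> r) (at r) \<and> isCont (nth_deriv 2 \<eta>) r"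
  proof -
    have two: "(\<eta> has_vector_derivative nth_deriv 1 \<eta> r) (at r) \<and>
        (nth_deriv 1 \<eta> has_vector_derivative nth_deriv 2 \<eta> r) (at r)"
      if "times_differentiable_on m \<eta> U" "m \<ge> 2" "r \<in> U" for m U
      using times_differentiable_onD[OF that(1) _ that(3), of 0] times_differentiable_onD[OF that(1) _ that(3), of 1] that(2)
      by (simp add: nth_deriv_simps(1) eval_nat_numeral)
    have cont: "isCont (nth_deriv 2 \<eta>) r" if "times_differentiable_on m \<eta> U" "m > 2" "r \<in> U" for m U
      using times_differentiable_onD[OF that] has_vector_derivative_continuous by blast
    show ?thesis
    proof (cases rule: knots_cover[OF n, of r \<rho>])
      case 1
      then have "times_differentiable_on 3 \<eta> {0<..<\<rho> 1}" "r \<in> {0<..<\<rho> 1}" using \<eta> r by (auto simp: S0_def)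
      then show ?thesis using two cont by (meson order_refl numeral_le_iff semiring_norm lessI numeral_less_iff)
    next
      case 2
      have "0 \<le> \<rho> n" using knots_pos[OF \<rho> n order_refl] by simp
      moreover have td: "times_differentiable_on 2 \<eta> {\<rho> n<..}" and "\<And>r. r \<in> {\<rho> n<..} \<Longrightarrow> op_R0 \<eta> r = 0"
        using \<eta> by (auto simp: S0_def)
      ultimately obtain \<beta> where \<beta>: "\<And>r. r > \<rho> n \<Longrightarrow> nth_deriv 2 \<eta> r = - ((1 / r) *\<^sub>R nth_deriv 1 \<eta> r)"
        using flux_law_last by metis
      have d: "(\<eta> has_vector_derivative nth_deriv 1 \<eta> r) (at r) \<and>
        (nth_deriv 1 \<eta> has_vector_derivative nth_deriv 2 \<eta> r) (at r)"
        using two[OF td] 2 by simp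
      then have "isCont (\<lambda>r. - ((1 / r) *\<^sub>R nth_deriv 1 \<eta> r)) r"
        using r by (intro continuous_intros) (auto intro: has_vector_derivative_continuous)
      moreover have "\<forall>\<^sub>F x in nhds r. - ((1 / x) *\<^sub>R nth_deriv 1 \<eta> x) = nth_deriv 2 \<eta> x"
        using eventually_nhds_in_open[of "{\<rho> n<..}" r] 2 \<beta> by (auto elim!: eventually_mono)
      ultimately have "isCont (nth_deriv 2 \<eta>) r"
        by (rule isCont_cong[THEN iffD1, rotated])
      then show ?thesis using d by blast
    next
      case (3 j)
      then have "C2_at \<eta> r" using \<eta> by (auto simp: S0_def)
      then show ?thesis using two[of 2] by (auto simp: C2_at_def)
    next
      case (4 j)
      then have "times_differentiable_on 4 \<eta> {\<rho> j<..<\<rho> (Suc j)}" using \<eta> by (auto simp: S0_def)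
      then show ?thesis using two[of 4] cont[of 4] 4 by auto
    qed
  qed
  then show "(\<eta> has_vector_derivative nth_deriv 1 \<eta> r) (at r)"
    "(nth_deriv 1 \<eta> has_vector_derivative nth_deriv 2 \<eta> r) (at r)"
    "isCont (nth_deriv 2 \<eta>) r" by auto
qed

section \<open>The energy inequality and its pointwise consequences\<close>

text \<open>The Cauchy-Schwarz inequality against the constant function, from the
  nonnegativity of the variance of \<open>\<psi>\<close>.\<close>

lemma square_integral_le:
  fixes \<psi> :: "real \<Rightarrow> real"
  assumes "p \<le> q" "\<psi> integrable_on {p..q}" "(\<lambda>x. (\<psi> x)\<^sup>2) integrable_on {p..q}"
  shows "(integral {p..q} \<psi>)\<^sup>2 \<le> (q - p) * integral {p..q} (\<lambda>x. (\<psi> x)\<^sup>2)"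
proof (cases "p = q")
  case False
  then have pq: "p < q" using assms(1) by simp
  define m where "m = integral {p..q} \<psi> / (q - p)"
  have avg: "integral {p..q} \<psi> = m * (q - p)" using pq by (simp add: m_def)
  have "((\<lambda>x. (\<psi> x)\<^sup>2 - (2 * m) * \<psi> x + m\<^sup>2) has_integral
      (integral {p..q} (\<lambda>x. (\<psi> x)\<^sup>2) - (2 * m) * integral {p..q} \<psi> + m\<^sup>2 * (q - p))) {p..q}"
    using assms has_integral_const_real[of "m\<^sup>2" p q] pq
    by (intro has_integral_add has_integral_diff has_integral_mult_right integrable_integral)
      (simp_all add: mult.commute)
  then have "((\<lambda>x. (\<psi> x - m)\<^sup>2) has_integral
      (integral {p..q} (\<lambda>x. (\<psi> x)\<^sup>2) - (2 * m) * integral {p..q} \<psi> + m\<^sup>2 * (q - p))) {p..q}"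
    by (rule has_integral_eq[rotated]) (simp add: power2_eq_square algebra_simps)
  then have "0 \<le> integral {p..q} (\<lambda>x. (\<psi> x)\<^sup>2) - (2 * m) * integral {p..q} \<psi> + m\<^sup>2 * (q - p)"
    by (rule has_integral_nonneg) simp
  also have "\<dots> = integral {p..q} (\<lambda>x. (\<psi> x)\<^sup>2) - m * (m * (q - p))"
    unfolding avg by (simp add: power2_eq_square)
  finally have "m * (m * (q - p)) \<le> integral {p..q} (\<lambda>x. (\<psi> x)\<^sup>2)" by simp
  then have "(q - p) * (m * (m * (q - p))) \<le> (q - p) * integral {p..q} (\<lambda>x. (\<psi> x)\<^sup>2)"
    using pq by (intro mult_left_mono) auto
  then show ?thesis unfolding avg by (simp add: power2_eq_square mult_ac)
qed simp

lemma compact_bound: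
  fixes h :: "real \<Rightarrow> complex"
  assumes "continuous_on {0<..} h" "0 < p"
  obtains M where "\<And>r. r \<in> {p..q} \<Longrightarrow> norm (h r) \<le> M"
proof -
  have "continuous_on {p..q} h"
    using assms by (auto intro: continuous_on_subset)
  then have "bounded (h ` {p..q})"
    by (intro compact_imp_bounded compact_continuous_image) auto
  then show thesis using that unfolding bounded_iff by blast
qed

definition gap_energy :: "(real \<Rightarrow> complex) \<Rightarrow> (real \<Rightarrow> complex) \<Rightarrow> real \<Rightarrow> real \<Rightarrow> real" where
  "gap_energy f \<sigma> p q = integral {p..q} (\<lambda>r. r * (norm (nth_deriv 2 f r - nth_deriv 2 \<sigma> r))\<^sup>2)"

text \<open>Everything up to the telescoping sum uses only that \<open>\<sigma>\<close> is \<open>C\<^sup>2\<close>; the spline enters through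
  \<^const>\<open>flux_law\<close> on the intervals considered.\<close>

locale smooth_competitor =
  fixes f \<sigma> :: "real \<Rightarrow> complex"
  assumes f: "f \<in> Lambda0"
    and \<sigma>1: "\<And>r. r > 0 \<Longrightarrow> (\<sigma> has_vector_derivative nth_deriv 1 \<sigma> r) (at r)"
    and \<sigma>2: "\<And>r. r > 0 \<Longrightarrow> (nth_deriv 1 \<sigma> has_vector_derivative nth_deriv 2 \<sigma> r) (at r)"
    and \<sigma>2_cont: "\<And>r. r > 0 \<Longrightarrow> isCont (nth_deriv 2 \<sigma>) r"
begin

abbreviation "g \<equiv> \<lambda>r. f r - \<sigma> r"
abbreviation "g1 \<equiv> \<lambda>r. nth_deriv 1 f r - nth_deriv 1 \<sigma> r"
abbreviation "g2 \<equiv> \<lambda>r. nth_deriv 2 f r - nth_deriv 2 \<sigma> r"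

lemma g_deriv: "r > 0 \<Longrightarrow> (g has_vector_derivative g1 r) (at r)"
  by (intro has_vector_derivative_diff Lambda0_deriv[OF f] \<sigma>1)

lemma g_cont: "continuous_on {0<..} g"
  using g_deriv has_vector_derivative_continuous
  by (intro continuous_at_imp_continuous_on) blast

lemma \<sigma>1_cont: "continuous_on {0<..} (nth_deriv 1 \<sigma>)"
  using \<sigma>2 has_vector_derivative_continuous
  by (intro continuous_at_imp_continuous_on) blast

lemma \<sigma>2_cont_on: "continuous_on {0<..} (nth_deriv 2 \<sigma>)"
  using \<sigma>2_cont by (intro continuous_at_imp_continuous_on) blast

lemma g1_cont: "continuous_on {0<..} g1"
  by (intro continuous_on_diff Lambda0_deriv_continuous[OF f] \<sigma>1_cont)

lemma g1_abs_cont: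
  assumes "0 < p" "p < q"
  shows "abs_cont g1 p q"
proof -
  obtain M where M: "\<And>r. r \<in> {p..q} \<Longrightarrow> norm (nth_deriv 2 \<sigma> r) \<le> M"
    using compact_bound[OF \<sigma>2_cont_on assms(1)] by metis
  have "abs_cont (\<lambda>r. - nth_deriv 1 \<sigma> r) p q"
  proof (rule abs_cont_bounded_derivative)
    show "continuous_on {p..q} (\<lambda>r. - nth_deriv 1 \<sigma> r)"
      using assms by (intro continuous_intros continuous_on_subset[OF \<sigma>1_cont]) auto
    fix r assume r: "r \<in> {p<..<q}"
    then show "((\<lambda>r. - nth_deriv 1 \<sigma> r) has_vector_derivative - nth_deriv 2 \<sigma> r) (at r)"
      using assms by (intro has_vector_derivative_minus \<sigma>2) auto
    show "norm (- nth_deriv 2 \<sigma> r) \<le> M" using M[of r] r by simp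
  qed
  from abs_cont_add[OF Lambda0_abs_cont[OF f assms] this] show ?thesis by simp
qed

lemma g1_deriv_ae:
  assumes "0 < p" "p < q"
  shows "\<exists>N. negligible N \<and> (\<forall>r\<in>{p..q} - N. (g1 has_vector_derivative g2 r) (at r))"
proof (intro exI conjI ballI)
  let ?N = "{x\<in>{p..q}. \<not> (nth_deriv 1 f has_vector_derivative vector_derivative (nth_deriv 1 f) (at x)) (at x)}"
  show "negligible ?N"
    by (rule abs_cont_has_vector_derivative_ae[OF Lambda0_abs_cont[OF f assms]])
  fix r assume r: "r \<in> {p..q} - ?N"
  then have "(nth_deriv 1 f has_vector_derivative nth_deriv 2 f r) (at r)"
    by (simp add: numeral_2_eq_2 nth_deriv_simps(2))
  then show "(g1 has_vector_derivative g2 r) (at r)"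
    using r assms by (intro has_vector_derivative_diff \<sigma>2) auto
qed

lemma g2_has_integral:
  assumes "0 < p" "p \<le> q"
  shows "(g2 has_integral g1 q - g1 p) {p..q}"
proof (cases "p = q")
  case False
  then have pq: "p < q" using assms by simp
  obtain N where N: "negligible N" "\<And>r. r \<in> {p..q} - N \<Longrightarrow> (g1 has_vector_derivative g2 r) (at r)"
    using g1_deriv_ae[OF assms(1) pq] by blast
  show ?thesis
    using g1_abs_cont[OF assms(1) pq] assms(2) N(1)
    by (rule abs_cont_fundamental_theorem) (use N(2) in \<open>auto intro: has_vector_derivative_at_within\<close>)
qed (simp add: has_integral_refl)

text \<open>The primitive of the mixed energy density of \<open>g\<close> and \<open>\<sigma>\<close> on a piece with flux constant \<open>c\<close>. At a
  zero of \<open>g\<close> it does not depend on \<open>c\<close>, so there its value with \<open>c = 0\<close> serves for both adjacent pieces.\<close>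

definition cross_potential :: "complex \<Rightarrow> real \<Rightarrow> real" where
  "cross_potential c r = (r *\<^sub>R nth_deriv 2 \<sigma> r) \<bullet> g1 r + c \<bullet> g r"

lemma cross_term_has_integral:
  assumes p: "0 < p" "p < q" and flux: "flux_law \<sigma> c {p<..<q}"
  shows "((\<lambda>r. ((1 / r) *\<^sub>R nth_deriv 1 \<sigma> r) \<bullet> g1 r + (r *\<^sub>R nth_deriv 2 \<sigma> r) \<bullet> g2 r)
    has_integral cross_potential c q - cross_potential c p) {p..q}"
proof -
  define m where "m r = r *\<^sub>R nth_deriv 2 \<sigma> r" for r
  have m_cont: "continuous_on {0<..} m"
    unfolding m_def by (intro continuous_intros \<sigma>2_cont_on)
  have m': "(m has_vector_derivative (1 / r) *\<^sub>R nth_deriv 1 \<sigma> r - c) (at r)" if "r \<in> {p<..<q}" for r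
    using flux that unfolding flux_law_def m_def[abs_def] by blast
  have m'_cont: "continuous_on {0<..} (\<lambda>r. (1 / r) *\<^sub>R nth_deriv 1 \<sigma> r - c)"
    by (intro continuous_intros \<sigma>1_cont) auto
  \<comment> \<open>By the flux law \<open>r \<sigma>''\<close> is Lipschitz, although nothing is known about the third derivative near
    the end points.\<close>
  obtain M where M: "\<And>r. r \<in> {p..q} \<Longrightarrow> norm ((1 / r) *\<^sub>R nth_deriv 1 \<sigma> r - c) \<le> M"
    using compact_bound[OF m'_cont p(1)] by metis
  have m_ac: "abs_cont m p q"
    by (rule abs_cont_bounded_derivative[OF continuous_on_subset[OF m_cont] m' M]) (use p in auto)
  obtain B1 where B1: "\<And>r. r \<in> {p..q} \<Longrightarrow> norm (m r) \<le> B1"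
    using compact_bound[OF m_cont p(1)] by metis
  obtain B2 where B2: "\<And>r. r \<in> {p..q} \<Longrightarrow> norm (g1 r) \<le> B2"
    using compact_bound[OF g1_cont p(1)] by metis
  have "abs_cont (\<lambda>r. m r \<bullet> g1 r) p q"
  proof (rule abs_cont_inner[OF m_ac g1_abs_cont[OF p], of "max B1 B2"])
    show "norm (m x) \<le> max B1 B2" "norm (g1 x) \<le> max B1 B2" if "x \<in> {p..q}" for x
      using B1[OF that] B2[OF that] by auto
  qed
  moreover have cg: "((\<lambda>r. c \<bullet> g r) has_vector_derivative c \<bullet> g1 r) (at r)" if "r > 0" for r
    using bounded_linear.has_vector_derivative[OF bounded_linear_inner_right g_deriv[OF that]] .
  have "abs_cont (\<lambda>r. c \<bullet> g r) p q"
  proof (rule abs_cont_bounded_derivative)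
    show "continuous_on {p..q} (\<lambda>r. c \<bullet> g r)"
      using p by (intro continuous_intros continuous_on_subset[OF g_cont]) auto
    fix r assume r: "r \<in> {p<..<q}"
    show "((\<lambda>r. c \<bullet> g r) has_vector_derivative c \<bullet> g1 r) (at r)" using cg r p by simp
    show "norm (c \<bullet> g1 r) \<le> norm c * B2"
      using Cauchy_Schwarz_ineq2[of c "g1 r"] B2[of r] r mult_left_mono[of "norm (g1 r)" B2 "norm c"] by simp
  qed
  ultimately have ac: "abs_cont (\<lambda>r. m r \<bullet> g1 r + c \<bullet> g r) p q" by (rule abs_cont_add)
  obtain N where N: "negligible N" "\<And>r. r \<in> {p..q} - N \<Longrightarrow> (g1 has_vector_derivative g2 r) (at r)"
    using g1_deriv_ae[OF p] by blast
  have "negligible (N \<union> {p, q})" using N(1) by (intro negligible_Un) auto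
  then show ?thesis
    unfolding cross_potential_def m_def[symmetric]
  proof (rule abs_cont_fundamental_theorem[OF ac less_imp_le[OF p(2)]])
    fix r assume r: "r \<in> {p..q} - (N \<union> {p, q})"
    then have r': "r \<in> {p<..<q}" by auto
    have "((\<lambda>r. m r \<bullet> g1 r + c \<bullet> g r) has_vector_derivative
        (m r \<bullet> g2 r + ((1 / r) *\<^sub>R nth_deriv 1 \<sigma> r - c) \<bullet> g1 r) + c \<bullet> g1 r) (at r)"
      using r r' p
      by (intro has_vector_derivative_add cg bounded_bilinear.has_vector_derivative[OF bounded_bilinear_inner] m' N(2)) auto
    then have "((\<lambda>r. m r \<bullet> g1 r + c \<bullet> g r) has_vector_derivative
        ((1 / r) *\<^sub>R nth_deriv 1 \<sigma> r) \<bullet> g1 r + m r \<bullet> g2 r) (at r)"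
      by (simp add: inner_diff_left algebra_simps)
    then show "((\<lambda>r. m r \<bullet> g1 r + c \<bullet> g r) has_vector_derivative
        ((1 / r) *\<^sub>R nth_deriv 1 \<sigma> r) \<bullet> g1 r + m r \<bullet> g2 r) (at r within {p..q})"
      by (rule has_vector_derivative_at_within)
  qed
qed

text \<open>Expand the energy density of \<open>f = \<sigma> + g\<close> and drop the energy density of \<open>\<sigma>\<close> together with the
  first-order part of that of \<open>g\<close>.\<close>

lemma density_split:
  assumes r: "r > 0"
  shows "r * (norm (g2 r))\<^sup>2 \<le> energy_density f r
    - 2 * (((1 / r) *\<^sub>R nth_deriv 1 \<sigma> r) \<bullet> g1 r + (r *\<^sub>R nth_deriv 2 \<sigma> r) \<bullet> g2 r)"
proof -
  define x2 y2 x1 y1 where "x2 = nth_deriv 2 f r" and "y2 = nth_deriv 2 \<sigma> r"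
    and "x1 = nth_deriv 1 f r" and "y1 = nth_deriv 1 \<sigma> r"
  have sq: "(norm x)\<^sup>2 = (norm y)\<^sup>2 + 2 * (y \<bullet> (x - y)) + (norm (x - y))\<^sup>2" for x y :: complex
  proof -
    have "(norm x)\<^sup>2 = (norm (y + (x - y)))\<^sup>2" by simp
    also have "\<dots> = (norm y)\<^sup>2 + 2 * (y \<bullet> (x - y)) + (norm (x - y))\<^sup>2"
      unfolding power2_norm_eq_inner inner_add_left inner_add_right
      using inner_commute[of "x - y" y] by linarith
    finally show ?thesis .
  qed
  have arith: "r * (a + 2 * b + c) + k * (d + 2 * e + h) - 2 * (k * e + r * b) = r * c + (r * a + k * (d + h))"
    for a b c d e h k :: real by (simp add: algebra_simps)
  have "energy_density f r - 2 * (((1 / r) *\<^sub>R y1) \<bullet> (x1 - y1) + (r *\<^sub>R y2) \<bullet> (x2 - y2))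
      = r * (norm (x2 - y2))\<^sup>2 + (r * (norm y2)\<^sup>2 + 1 / r * ((norm y1)\<^sup>2 + (norm (x1 - y1))\<^sup>2))"
    unfolding energy_density_def x1_def[symmetric] x2_def[symmetric] sq[of x2 y2] sq[of x1 y1] inner_scaleR_left
    by (rule arith)
  moreover have "0 \<le> r * (norm y2)\<^sup>2 + 1 / r * ((norm y1)\<^sup>2 + (norm (x1 - y1))\<^sup>2)"
    using r by simp
  ultimately show ?thesis unfolding x1_def y1_def x2_def y2_def by linarith
qed

text \<open>Even integrability of the weighted \<open>\<bar>g''\<bar>\<^sup>2\<close> comes from here, by domination: the right-hand
  side of \<open>density_split\<close> is integrable, being an energy density minus a derivative.\<close>

lemma gap_energy_le:
  assumes p: "0 < p" "p < q" and flux: "flux_law \<sigma> c {p<..<q}"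
  shows "(\<lambda>r. r * (norm (g2 r))\<^sup>2) integrable_on {p..q}"
    "gap_energy f \<sigma> p q \<le> integral {p..q} (energy_density f) - 2 * (cross_potential c q - cross_potential c p)"
proof -
  let ?cross = "\<lambda>r. ((1 / r) *\<^sub>R nth_deriv 1 \<sigma> r) \<bullet> g1 r + (r *\<^sub>R nth_deriv 2 \<sigma> r) \<bullet> g2 r"
  have bound: "((\<lambda>r. energy_density f r - 2 * ?cross r) has_integral
      integral {p..q} (energy_density f) - 2 * (cross_potential c q - cross_potential c p)) {p..q}"
    by (intro has_integral_diff has_integral_mult_right cross_term_has_integral[OF p flux]
        integrable_integral Lambda0_energy_interval(1)[OF f p(1)])
  have "g2 \<in> borel_measurable (lebesgue_on {p..q})"
    using g2_has_integral[of p q] p by (intro integrable_imp_measurable) auto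
  moreover have "(\<lambda>r. r) \<in> borel_measurable (lebesgue_on {p..q})"
    by (intro continuous_imp_measurable_on_sets_lebesgue) auto
  ultimately have meas: "(\<lambda>r. r * (norm (g2 r))\<^sup>2) \<in> borel_measurable (lebesgue_on {p..q})"
    by measurable
  show int: "(\<lambda>r. r * (norm (g2 r))\<^sup>2) integrable_on {p..q}"
  proof (rule measurable_bounded_by_integrable_imp_integrable[OF meas])
    show "(\<lambda>r. energy_density f r - 2 * ?cross r) integrable_on {p..q}" using bound by blast
    show "norm (r * (norm (g2 r))\<^sup>2) \<le> energy_density f r - 2 * ?cross r" if "r \<in> {p..q}" for r
      using density_split[of r] that p by simp
  qed auto
  show "gap_energy f \<sigma> p q \<le> integral {p..q} (energy_density f) - 2 * (cross_potential c q - cross_potential c p)"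
    unfolding gap_energy_def
  proof (rule has_integral_le[OF integrable_integral[OF int] bound])
    fix r assume "r \<in> {p..q}"
    then have "r > 0" using p by simp
    then show "r * (norm (g2 r))\<^sup>2 \<le> energy_density f r - 2 * ?cross r" by (rule density_split)
  qed
qed

lemma gap_energy_nonneg:
  assumes "0 < p" "p < q" "flux_law \<sigma> c {p<..<q}"
  shows "0 \<le> gap_energy f \<sigma> p q"
  unfolding gap_energy_def
  by (rule integral_nonneg[OF gap_energy_le(1)[OF assms]]) (use assms in auto)

text \<open>A real-linear image of \<open>g\<close> vanishes at both end points, so its derivative has a zero \<open>z\<close> inside; integrate
  the second derivative from \<open>z\<close>. Rolle's theorem fails for complex values, so this is applied to the
  real and the imaginary part.\<close>

lemma deriv_component_bound:
  fixes L :: "complex \<Rightarrow> real"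
  assumes L: "bounded_linear L" and p: "0 < p" "p < q"
    and sq: "(\<lambda>r. (L (g2 r))\<^sup>2) integrable_on {p..q}"
    and zero: "g p = 0" "g q = 0" and r: "r \<in> {p..q}"
  shows "(L (g1 r))\<^sup>2 \<le> (q - p) * integral {p..q} (\<lambda>r. (L (g2 r))\<^sup>2)"
proof -
  interpret L: bounded_linear L by (rule L)
  have "\<exists>z. p < z \<and> z < q \<and> L (g1 z) = 0"
  proof -
    have der: "((\<lambda>r. L (g r)) has_real_derivative L (g1 x)) (at x)" if "x > 0" for x
      using L.has_vector_derivative[OF g_deriv[OF that]]
      by (simp add: has_real_derivative_iff_has_vector_derivative)
    have "continuous_on {p..q} (\<lambda>r. L (g r))"
      using p by (intro L.continuous_on continuous_on_subset[OF g_cont]) auto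
    then obtain z where "p < z" "z < q" "DERIV (\<lambda>r. L (g r)) z :> 0"
      using Rolle[of p q "\<lambda>r. L (g r)"] zero p der by (metis L.zero less_trans real_differentiable_def)
    moreover have "DERIV (\<lambda>r. L (g r)) z :> L (g1 z)" using der \<open>p < z\<close> p by simp
    ultimately show ?thesis using DERIV_unique by blast
  qed
  then obtain z where z: "p < z" "z < q" "L (g1 z) = 0" by blast
  define u v where "u = min z r" and "v = max z r"
  have uv: "u \<le> v" "p \<le> u" "v \<le> q" using z r by (auto simp: u_def v_def)
  have Lint: "((\<lambda>r. L (g2 r)) has_integral L (g1 v - g1 u)) {u..v}"
    using has_integral_linear[OF g2_has_integral[of u v] L] uv p by (simp add: o_def)
  have sq': "(\<lambda>r. (L (g2 r))\<^sup>2) integrable_on {u..v}"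
    by (rule integrable_on_subinterval[OF sq]) (use uv in auto)
  have "(L (g1 r))\<^sup>2 = (L (g1 v - g1 u))\<^sup>2"
  proof (cases "z \<le> r")
    case True
    then show ?thesis unfolding u_def v_def L.diff[of "g1 _"] using z(3) by simp
  next
    case False
    then show ?thesis unfolding u_def v_def L.diff[of "g1 _"] using z(3) by simp
  qed
  also have "\<dots> \<le> (v - u) * integral {u..v} (\<lambda>r. (L (g2 r))\<^sup>2)"
    using square_integral_le[OF uv(1) has_integral_integrable[OF Lint] sq']
    unfolding integral_unique[OF Lint] .
  also have "\<dots> \<le> (q - p) * integral {p..q} (\<lambda>r. (L (g2 r))\<^sup>2)"
  proof (rule mult_mono)
    show "integral {u..v} (\<lambda>r. (L (g2 r))\<^sup>2) \<le> integral {p..q} (\<lambda>r. (L (g2 r))\<^sup>2)"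
      by (rule integral_subset_le[OF _ sq' sq]) (use uv in auto)
    show "0 \<le> integral {u..v} (\<lambda>r. (L (g2 r))\<^sup>2)" by (rule integral_nonneg[OF sq']) simp
  qed (use uv p in auto)
  finally show ?thesis .
qed

lemma deriv_bound:
  assumes p: "0 < p" "p < q" and flux: "flux_law \<sigma> c {p<..<q}"
    and zero: "g p = 0" "g q = 0" and r: "r \<in> {p..q}"
  shows "(norm (g1 r))\<^sup>2 \<le> (q - p) / p * gap_energy f \<sigma> p q"
proof -
  have meas: "g2 \<in> borel_measurable (lebesgue_on {p..q})"
    using g2_has_integral[of p q] p by (intro integrable_imp_measurable) auto
  have int: "(\<lambda>r. r * (norm (g2 r))\<^sup>2) integrable_on {p..q}" by (rule gap_energy_le(1)[OF p flux])
  have dom: "(norm (g2 r))\<^sup>2 \<le> 1 / p * (r * (norm (g2 r))\<^sup>2)" if "r \<in> {p..q}" for r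
    using that p mult_right_mono[of p r "(norm (g2 r))\<^sup>2"] by (simp add: field_simps)
  have scaled: "(\<lambda>r. 1 / p * (r * (norm (g2 r))\<^sup>2)) integrable_on {p..q}"
    using int by (rule integrable_on_mult_right)
  have comp: "(\<lambda>r. (L (g2 r))\<^sup>2) integrable_on {p..q}"
    if L: "L \<in> {Re, Im}" for L :: "complex \<Rightarrow> real"
  proof (rule measurable_bounded_by_integrable_imp_integrable[OF _ scaled])
    have "bounded_linear L" using L bounded_linear_Re bounded_linear_Im by blast
    then have "L \<in> borel_measurable borel"
      by (intro borel_measurable_continuous_onI linear_continuous_on)
    then show "(\<lambda>r. (L (g2 r))\<^sup>2) \<in> borel_measurable (lebesgue_on {p..q})"
      using meas by measurable
    show "norm ((L (g2 r))\<^sup>2) \<le> 1 / p * (r * (norm (g2 r))\<^sup>2)" if "r \<in> {p..q}" for r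
    proof -
      have "(L (g2 r))\<^sup>2 \<le> (norm (g2 r))\<^sup>2"
        using L abs_Re_le_cmod[of "g2 r"] abs_Im_le_cmod[of "g2 r"]
        by (auto simp: abs_le_square_iff[symmetric])
      then show ?thesis using dom[OF that] by simp
    qed
  qed auto
  have "(norm (g1 r))\<^sup>2 = (Re (g1 r))\<^sup>2 + (Im (g1 r))\<^sup>2" by (rule cmod_power2)
  also have "\<dots> \<le> (q - p) * integral {p..q} (\<lambda>r. (Re (g2 r))\<^sup>2) + (q - p) * integral {p..q} (\<lambda>r. (Im (g2 r))\<^sup>2)"
    by (intro add_mono deriv_component_bound p comp zero r bounded_linear_Re bounded_linear_Im) auto
  also have "\<dots> = (q - p) * integral {p..q} (\<lambda>r. (Re (g2 r))\<^sup>2 + (Im (g2 r))\<^sup>2)"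
    using integral_add[OF comp[of Re] comp[of Im]] by (simp add: distrib_left)
  also have "\<dots> \<le> (q - p) * integral {p..q} (\<lambda>r. 1 / p * (r * (norm (g2 r))\<^sup>2))"
  proof (rule mult_left_mono)
    show "integral {p..q} (\<lambda>r. (Re (g2 r))\<^sup>2 + (Im (g2 r))\<^sup>2) \<le> integral {p..q} (\<lambda>r. 1 / p * (r * (norm (g2 r))\<^sup>2))"
    proof (rule integral_le[OF integrable_add[OF comp comp] scaled])
      show "(Re (g2 r))\<^sup>2 + (Im (g2 r))\<^sup>2 \<le> 1 / p * (r * (norm (g2 r))\<^sup>2)" if "r \<in> {p..q}" for r
        using dom[OF that] unfolding cmod_power2 .
    qed auto
  qed (use p in auto)
  also have "\<dots> = (q - p) / p * gap_energy f \<sigma> p q"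
    by (simp add: gap_energy_def)
  finally show ?thesis .
qed

text \<open>Integrating from the nearer end point gives the factor \<open>1 / 2\<close>.\<close>

lemma value_bound:
  assumes p: "0 < p" "p < q" and zero: "g p = 0" "g q = 0"
    and B: "\<And>r. r \<in> {p..q} \<Longrightarrow> norm (g1 r) \<le> B" and r: "r \<in> {p..q}"
  shows "norm (g r) \<le> (q - p) / 2 * B"
proof -
  have lip: "norm (g v - g u) \<le> B * (v - u)" if "p \<le> u" "u \<le> v" "v \<le> q" for u v
  proof (cases "u = v")
    case False
    have "norm (g v - g u) \<le> B * v - B * u"
    proof (rule differentiable_bound_general[where f' = g1 and \<phi>' = "\<lambda>_. B"])
      show "continuous_on {u..v} g" using that p by (intro continuous_on_subset[OF g_cont]) auto
      show "((*) B has_vector_derivative B) (at x)" for x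
        by (auto intro!: derivative_eq_intros simp: has_real_derivative_iff_has_vector_derivative[symmetric])
    qed (use that False p g_deriv B in \<open>auto intro!: continuous_intros\<close>)
    then show ?thesis by (simp add: algebra_simps)
  qed simp
  have "norm (g r) \<le> B * (r - p)" using lip[of p r] zero r by simp
  moreover have "norm (g r) \<le> B * (q - r)" using lip[of r q] zero r by (simp add: norm_minus_commute)
  ultimately show ?thesis by (simp add: field_simps)
qed

end

lemma flux_law_subset: "flux_law \<eta> c S \<Longrightarrow> T \<subseteq> S \<Longrightarrow> flux_law \<eta> c T"
  by (auto simp: flux_law_def)

context smooth_competitor
begin

lemma gap_energy_pieces_le:
  assumes kn: "knots n \<rho>" and k: "1 \<le> k" "k \<le> n"
    and zero: "\<And>j. j \<in> {1..n} \<Longrightarrow> g (\<rho> j) = 0"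
    and flux: "\<And>j. j \<in> {1..n - 1} \<Longrightarrow> \<exists>c. flux_law \<sigma> c {\<rho> j<..<\<rho> (Suc j)}"
  shows "(\<Sum>j\<in>{1..<k}. gap_energy f \<sigma> (\<rho> j) (\<rho> (Suc j)))
    \<le> integral {\<rho> 1..\<rho> k} (energy_density f) - 2 * (cross_potential 0 (\<rho> k) - cross_potential 0 (\<rho> 1))"
  using k
proof (induction k rule: dec_induct)
  case base
  then show ?case by simp
next
  case (step k)
  have k: "1 \<le> k" "k < n" using step.hyps step.prems by auto
  have "k \<in> {1..n - 1}" using k by simp
  then obtain c where c: "flux_law \<sigma> c {\<rho> k<..<\<rho> (Suc k)}"
    using flux by blast
  have pos: "0 < \<rho> 1" "0 < \<rho> k" "\<rho> k < \<rho> (Suc k)" "\<rho> 1 \<le> \<rho> k"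
    using knots_pos[OF kn, of 1] knots_pos[OF kn, of k] knots_mono[OF kn, of k "Suc k"] knots_mono_le[OF kn, of 1 k] k
    by auto
  have bt: "cross_potential c (\<rho> j) = cross_potential 0 (\<rho> j)" if "j \<in> {1..n}" for j
    using zero[OF that] by (simp add: cross_potential_def)
  have "gap_energy f \<sigma> (\<rho> k) (\<rho> (Suc k))
      \<le> integral {\<rho> k..\<rho> (Suc k)} (energy_density f) - 2 * (cross_potential 0 (\<rho> (Suc k)) - cross_potential 0 (\<rho> k))"
    using gap_energy_le(2)[OF pos(2,3) c] bt[of k] bt[of "Suc k"] k by simp
  moreover have "(\<Sum>j\<in>{1..<k}. gap_energy f \<sigma> (\<rho> j) (\<rho> (Suc j)))
    \<le> integral {\<rho> 1..\<rho> k} (energy_density f) - 2 * (cross_potential 0 (\<rho> k) - cross_potential 0 (\<rho> 1))"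
    using step.IH k by simp
  moreover have "integral {\<rho> 1..\<rho> k} (energy_density f) + integral {\<rho> k..\<rho> (Suc k)} (energy_density f)
      = integral {\<rho> 1..\<rho> (Suc k)} (energy_density f)"
    using pos by (intro Henstock_Kurzweil_Integration.integral_combine Lambda0_energy_interval(1)[OF f]) auto
  moreover have "(\<Sum>j\<in>{1..<Suc k}. gap_energy f \<sigma> (\<rho> j) (\<rho> (Suc j)))
      = (\<Sum>j\<in>{1..<k}. gap_energy f \<sigma> (\<rho> j) (\<rho> (Suc j))) + gap_energy f \<sigma> (\<rho> k) (\<rho> (Suc k))"
    using k by simp
  ultimately show ?case by argo
qed

text \<open>Extend the sum over the inner pieces by \<open>[a, \<rho> 1]\<close> and \<open>[\<rho> n, b]\<close>; by telescoping only the
  potentials at \<open>a\<close> and \<open>b\<close> remain. They are made small by taking \<open>a\<close> near 0 and \<open>b\<close> near infinity at points where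
  \<open>f'\<close> is small.\<close>

lemma gap_energy_total_le:
  assumes kn: "knots n \<rho>" and n: "1 \<le> n"
    and zero: "\<And>j. j \<in> {1..n} \<Longrightarrow> g (\<rho> j) = 0"
    and flux: "\<And>j. j \<in> {1..n - 1} \<Longrightarrow> \<exists>c. flux_law \<sigma> c {\<rho> j<..<\<rho> (Suc j)}"
    and first: "flux_law \<sigma> c {0<..<\<rho> 1}"
    and last: "flux_law \<sigma> 0 {\<rho> n<..}"
    and s1_0: "(nth_deriv 1 \<sigma> \<longlongrightarrow> 0) (at_right 0)"
    and s2_0: "((\<lambda>r. r *\<^sub>R nth_deriv 2 \<sigma> r) \<longlongrightarrow> 0) (at_right 0)"
    and cg_0: "((\<lambda>r. c \<bullet> g r) \<longlongrightarrow> 0) (at_right 0)"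
    and s1_inf: "(nth_deriv 1 \<sigma> \<longlongrightarrow> 0) at_top"
    and s2_inf: "((\<lambda>r. r *\<^sub>R nth_deriv 2 \<sigma> r) \<longlongrightarrow> 0) at_top"
  shows "(\<Sum>j\<in>{1..<n}. gap_energy f \<sigma> (\<rho> j) (\<rho> (Suc j))) \<le> (norm0 f)\<^sup>2"
proof (rule field_le_epsilon)
  fix e :: real assume e: "e > 0"
  \<comment> \<open>Three quantities of size at most \<open>\<eta>\<close> remain, each with the factor 2 of the mixed term.\<close>
  define \<eta> where "\<eta> = e / 6"
  have \<eta>: "\<eta> > 0" using e by (simp add: \<eta>_def)
  have bt_small: "\<bar>cross_potential 0 r\<bar> \<le> \<eta>"
    if "norm (r *\<^sub>R nth_deriv 2 \<sigma> r) < 1" "norm (nth_deriv 1 \<sigma> r) < \<eta> / 2" "norm (nth_deriv 1 f r) < \<eta> / 2" for r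
  proof -
    have "\<bar>cross_potential 0 r\<bar> \<le> norm (r *\<^sub>R nth_deriv 2 \<sigma> r) * norm (g1 r)"
      by (simp only: cross_potential_def inner_zero_left add_0_right Cauchy_Schwarz_ineq2)
    also have "\<dots> \<le> 1 * (\<eta> / 2 + \<eta> / 2)"
      using that norm_triangle_ineq4[of "nth_deriv 1 f r" "nth_deriv 1 \<sigma> r"] by (intro mult_mono) auto
    finally show ?thesis by simp
  qed
  have r1: "0 < \<rho> 1" "0 < \<rho> n" "\<rho> 1 \<le> \<rho> n"
    using knots_pos[OF kn, of 1] knots_pos[OF kn, of n] knots_mono_le[OF kn, of 1 n] n by auto
  have "\<forall>\<^sub>F r in at_right 0. norm (r *\<^sub>R nth_deriv 2 \<sigma> r) < 1 \<and> norm (nth_deriv 1 \<sigma> r) < \<eta> / 2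
      \<and> \<bar>c \<bullet> g r\<bar> < \<eta>"
    using tendstoD[OF s2_0, of 1] tendstoD[OF s1_0, of "\<eta> / 2"] tendstoD[OF cg_0 \<eta>] \<eta>
    by (auto simp: dist_norm eventually_conj_iff simp del: norm_scaleR)
  then obtain d where d: "d > 0" "\<And>r. 0 < r \<Longrightarrow> r < d \<Longrightarrow> norm (r *\<^sub>R nth_deriv 2 \<sigma> r) < 1 \<and> norm (nth_deriv 1 \<sigma> r) < \<eta> / 2
      \<and> \<bar>c \<bullet> g r\<bar> < \<eta>"
    unfolding eventually_at_right_field by blast
  obtain a where a: "0 < a" "a < min d (\<rho> 1)" "norm (nth_deriv 1 f a) < \<eta> / 2"
    using Lambda0_deriv_small_near_0[OF f, of "\<eta> / 2" "min d (\<rho> 1)"] \<eta> d(1) r1 by auto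
  have a_small: "\<bar>cross_potential 0 a\<bar> \<le> \<eta>" "\<bar>c \<bullet> g a\<bar> < \<eta>"
    using bt_small[of a] d(2)[of a] a by auto
  have "\<forall>\<^sub>F r in at_top. norm (r *\<^sub>R nth_deriv 2 \<sigma> r) < 1 \<and> norm (nth_deriv 1 \<sigma> r) < \<eta> / 2"
    using tendstoD[OF s2_inf, of 1] tendstoD[OF s1_inf, of "\<eta> / 2"] \<eta>
    by (auto simp: dist_norm eventually_conj_iff simp del: norm_scaleR)
  then obtain D where D: "\<And>r. r \<ge> D \<Longrightarrow> norm (r *\<^sub>R nth_deriv 2 \<sigma> r) < 1 \<and> norm (nth_deriv 1 \<sigma> r) < \<eta> / 2"
    unfolding eventually_at_top_linorder by blast
  obtain b where b: "max D (\<rho> n) < b" "norm (nth_deriv 1 f b) < \<eta> / 2"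
    using Lambda0_deriv_small_near_infinity[OF f, of "\<eta> / 2" "max D (\<rho> n)"] \<eta> r1 by (auto simp: less_max_iff_disj)
  have b_small: "\<bar>cross_potential 0 b\<bar> \<le> \<eta>"
    using bt_small[of b] D[of b] b by auto
  have fa: "flux_law \<sigma> c {a<..<\<rho> 1}" by (rule flux_law_subset[OF first]) (use a in auto)
  have fb: "flux_law \<sigma> 0 {\<rho> n<..<b}" by (rule flux_law_subset[OF last]) auto
  have "0 \<le> integral {a..\<rho> 1} (energy_density f) - 2 * (cross_potential c (\<rho> 1) - cross_potential c a)"
    using gap_energy_nonneg[OF a(1) _ fa] gap_energy_le(2)[OF a(1) _ fa] a by simp
  moreover have "cross_potential c (\<rho> 1) = cross_potential 0 (\<rho> 1)"
    using zero[of 1] n by (simp add: cross_potential_def)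
  moreover have "cross_potential c a = cross_potential 0 a + c \<bullet> g a"
    by (simp add: cross_potential_def)
  moreover have "0 \<le> integral {\<rho> n..b} (energy_density f) - 2 * (cross_potential 0 b - cross_potential 0 (\<rho> n))"
    using gap_energy_nonneg[OF r1(2) _ fb] gap_energy_le(2)[OF r1(2) _ fb] b by simp
  moreover have "(\<Sum>j\<in>{1..<n}. gap_energy f \<sigma> (\<rho> j) (\<rho> (Suc j)))
    \<le> integral {\<rho> 1..\<rho> n} (energy_density f) - 2 * (cross_potential 0 (\<rho> n) - cross_potential 0 (\<rho> 1))"
    by (rule gap_energy_pieces_le[OF kn n order_refl zero flux])
  moreover have "integral {a..\<rho> 1} (energy_density f) + integral {\<rho> 1..\<rho> n} (energy_density f)
      = integral {a..\<rho> n} (energy_density f)"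
    using a r1 by (intro Henstock_Kurzweil_Integration.integral_combine Lambda0_energy_interval(1)[OF f]) auto
  moreover have "integral {a..\<rho> n} (energy_density f) + integral {\<rho> n..b} (energy_density f)
      = integral {a..b} (energy_density f)"
    using a b r1 by (intro Henstock_Kurzweil_Integration.integral_combine Lambda0_energy_interval(1)[OF f]) auto
  moreover have "integral {a..b} (energy_density f) \<le> (norm0 f)\<^sup>2"
    by (rule Lambda0_energy_interval(2)[OF f a(1)])
  moreover have "e = 6 * \<eta>" by (simp add: \<eta>_def)
  ultimately show "(\<Sum>j\<in>{1..<n}. gap_energy f \<sigma> (\<rho> j) (\<rho> (Suc j))) \<le> (norm0 f)\<^sup>2 + e"
    using abs_le_D1[OF a_small(1)] abs_le_D1[OF less_imp_le[OF a_small(2)]] abs_le_D2[OF b_small]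
    by argo
qed

end

text \<open>The two kinds of interpolant are distinguished only in the proof that \<open>c \<bullet> g\<close> tends to 0 at the
  origin.\<close>

lemma interpolant_energy:
  assumes n: "1 \<le> n" and kn: "knots n \<rho>" and f: "f \<in> Lambda0"
    and int: "interpolant_A n \<rho> f \<sigma> \<or> interpolant_B n \<rho> f \<sigma>"
  shows "smooth_competitor f \<sigma>"
    "\<And>j. j \<in> {1..n} \<Longrightarrow> f (\<rho> j) - \<sigma> (\<rho> j) = 0"
    "\<And>j. j \<in> {1..n - 1} \<Longrightarrow> \<exists>c. flux_law \<sigma> c {\<rho> j<..<\<rho> (Suc j)}"
    "(\<Sum>j\<in>{1..<n}. gap_energy f \<sigma> (\<rho> j) (\<rho> (Suc j))) \<le> (norm0 f)\<^sup>2"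
proof -
  have S: "\<sigma> \<in> S0 n \<rho>" using int by (auto simp: interpolant_A_def interpolant_B_def)
  have r1: "0 < \<rho> 1" "0 < \<rho> n" using knots_pos[OF kn, of 1] knots_pos[OF kn, of n] n by auto
  show sc: "smooth_competitor f \<sigma>"
    using f S0_regularity[OF n kn S] by unfold_locales
  then interpret smooth_competitor f \<sigma> .
  show zero: "f (\<rho> j) - \<sigma> (\<rho> j) = 0" if "j \<in> {1..n}" for j
    using int that by (auto simp: interpolant_A_def interpolant_B_def)
  show flux: "\<exists>c. flux_law \<sigma> c {\<rho> j<..<\<rho> (Suc j)}" if "j \<in> {1..n - 1}" for j
  proof -
    have "times_differentiable_on 4 \<sigma> {\<rho> j<..<\<rho> (Suc j)}" "\<And>r. r \<in> {\<rho> j<..<\<rho> (Suc j)} \<Longrightarrow> op_L0 \<sigma> r = 0"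
      using S that by (auto simp: S0_def)
    moreover have "0 < \<rho> j" using knots_pos[OF kn, of j] that by auto
    ultimately show ?thesis using flux_law_inner by metis
  qed
  have "times_differentiable_on 3 \<sigma> {0<..<\<rho> 1}" "\<And>r. r \<in> {0<..<\<rho> 1} \<Longrightarrow> op_G0 \<sigma> r = 0"
    using S by (auto simp: S0_def)
  then obtain c where c: "flux_law \<sigma> c {0<..<\<rho> 1}"
    "\<And>r. r \<in> {0<..<\<rho> 1} \<Longrightarrow> nth_deriv 2 \<sigma> r = (1 / r) *\<^sub>R nth_deriv 1 \<sigma> r - c /\<^sub>R 2"
    using flux_law_first by metis
  have "times_differentiable_on 2 \<sigma> {\<rho> n<..}" "\<And>r. r \<in> {\<rho> n<..} \<Longrightarrow> op_R0 \<sigma> r = 0" "0 \<le> \<rho> n"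
    using S r1 by (auto simp: S0_def)
  then obtain \<beta> where \<beta>: "flux_law \<sigma> 0 {\<rho> n<..}" "\<And>r. r > \<rho> n \<Longrightarrow> nth_deriv 1 \<sigma> r = (1 / r) *\<^sub>R \<beta>"
    "\<And>r. r > \<rho> n \<Longrightarrow> nth_deriv 2 \<sigma> r = - ((1 / r) *\<^sub>R nth_deriv 1 \<sigma> r)"
    using flux_law_last by metis
  have near0: "\<forall>\<^sub>F r in at_right 0. r \<in> {0<..<\<rho> 1}"
    using eventually_at_right_real[OF r1(1)] .
  have s1_0: "(nth_deriv 1 \<sigma> \<longlongrightarrow> 0) (at_right 0)"
    by (rule first_piece_deriv_tendsto_0[OF r1(1) _ c(2)]) (use \<sigma>2 in auto)
  have s2_0: "((\<lambda>r. r *\<^sub>R nth_deriv 2 \<sigma> r) \<longlongrightarrow> 0) (at_right 0)"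
  proof -
    have "((\<lambda>r. nth_deriv 1 \<sigma> r - r *\<^sub>R (c /\<^sub>R 2)) \<longlongrightarrow> 0 - 0 *\<^sub>R (c /\<^sub>R 2)) (at_right 0)"
      by (intro tendsto_diff tendsto_scaleR s1_0 tendsto_const tendsto_ident_at)
    moreover have "\<forall>\<^sub>F r in at_right 0. nth_deriv 1 \<sigma> r - r *\<^sub>R (c /\<^sub>R 2) = r *\<^sub>R nth_deriv 2 \<sigma> r"
      using near0 by eventually_elim (simp add: c(2) scaleR_diff_right)
    ultimately show ?thesis by (simp add: Lim_transform_eventually)
  qed
  have cg_0: "((\<lambda>r. c \<bullet> (f r - \<sigma> r)) \<longlongrightarrow> 0) (at_right 0)"
    using int
  proof
    assume A: "interpolant_A n \<rho> f \<sigma>"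
    have "(\<sigma> \<longlongrightarrow> \<sigma> 0) (at 0 within {0..})"
      using S by (auto simp: S0_def continuous_within)
    then have "(\<sigma> \<longlongrightarrow> \<sigma> 0) (at_right 0)"
      by (rule tendsto_within_subset) auto
    then have "((\<lambda>r. c \<bullet> (f r - \<sigma> r)) \<longlongrightarrow> c \<bullet> (value_at_0 f - \<sigma> 0)) (at_right 0)"
      by (intro tendsto_intros Lambda0_tendsto_value_at_0[OF f])
    then show ?thesis using A by (simp add: interpolant_A_def)
  next
    assume "interpolant_B n \<rho> f \<sigma>"
    then obtain a b where "\<And>r. r \<in> {0<..<\<rho> 1} \<Longrightarrow> \<sigma> r = a * of_real (r\<^sup>2) + b"
      by (auto simp: interpolant_B_def non_singular_def)
    then have "c = 0" using non_singular_flux_zero[OF r1(1) _ c(2)] by blast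
    then show ?thesis by simp
  qed
  have far: "\<forall>\<^sub>F r in at_top. r > \<rho> n" by (rule eventually_gt_at_top)
  have s1_inf: "(nth_deriv 1 \<sigma> \<longlongrightarrow> 0) at_top"
  proof -
    have "((\<lambda>r. (1 / r) *\<^sub>R \<beta>) \<longlongrightarrow> 0 *\<^sub>R \<beta>) at_top"
      by (intro tendsto_scaleR tendsto_const) (simp add: tendsto_inverse_0_at_top filterlim_ident flip: inverse_eq_divide)
    moreover have "\<forall>\<^sub>F r in at_top. (1 / r) *\<^sub>R \<beta> = nth_deriv 1 \<sigma> r"
      using far by eventually_elim (rule \<beta>(2)[symmetric])
    ultimately show ?thesis by (simp add: Lim_transform_eventually)
  qed
  have s2_inf: "((\<lambda>r. r *\<^sub>R nth_deriv 2 \<sigma> r) \<longlongrightarrow> 0) at_top"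
  proof -
    have "((\<lambda>r. - nth_deriv 1 \<sigma> r) \<longlongrightarrow> - 0) at_top" by (intro tendsto_minus s1_inf)
    moreover have "\<forall>\<^sub>F r in at_top. - nth_deriv 1 \<sigma> r = r *\<^sub>R nth_deriv 2 \<sigma> r"
      using far by eventually_elim (use \<beta>(3) r1 in simp)
    ultimately show ?thesis by (simp add: Lim_transform_eventually)
  qed
  show "(\<Sum>j\<in>{1..<n}. gap_energy f \<sigma> (\<rho> j) (\<rho> (Suc j))) \<le> (norm0 f)\<^sup>2"
    by (rule gap_energy_total_le[OF kn n zero flux c(1) \<beta>(1) s1_0 s2_0 cg_0 s1_inf s2_inf])
qed

lemma knots_cover_closed:
  assumes kn: "knots n \<rho>" and n: "2 \<le> n" and r: "r \<in> {\<rho> 1..\<rho> n}"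
  obtains j where "j \<in> {1..<n}" "r \<in> {\<rho> j..\<rho> (Suc j)}"
proof -
  have "1 \<le> n" using n by simp
  then show thesis
  proof (cases rule: knots_cover[of n r \<rho>])
    case (3 j)
    show thesis
    proof (cases "j = n")
      case True
      then show thesis
        using that[of "n - 1"] 3 n knots_mono_le[OF kn, of "n - 1" n] by auto
    next
      case False
      then show thesis
        using that[of j] 3 knots_mono_le[OF kn, of j "Suc j"] by auto
    qed
  next
    case (4 j)
    then show thesis using that[of j] by auto
  qed (use r in auto)
qed

lemma mesh_ge:
  assumes "j \<in> {1..<n}"
  shows "\<rho> (Suc j) - \<rho> j \<le> mesh n \<rho>"
  unfolding mesh_def using assms by (intro Max_ge) auto

section \<open>From the pieces to the error estimate\<close>

text \<open>Each of the numbers is at most \<open>T\<close>, so \<open>E j powr s \<le> E j * T powr (s - 1)\<close>.\<close>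

lemma sum_powr_le:
  fixes E :: "'a \<Rightarrow> real"
  assumes "finite A" "\<And>j. j \<in> A \<Longrightarrow> 0 \<le> E j" "1 \<le> s" "(\<Sum>j\<in>A. E j) \<le> T"
  shows "(\<Sum>j\<in>A. E j powr s) \<le> T powr s"
proof -
  have le: "E j \<le> T" if "j \<in> A" for j
    using member_le_sum[of j A E] assms that by fastforce
  have T: "0 \<le> T" using sum_nonneg[of A E] assms by fastforce
  have split: "x powr s = x * x powr (s - 1)" if "0 \<le> x" for x :: real
    using powr_mult_base[OF that, of "s - 1"] by simp
  have "(\<Sum>j\<in>A. E j powr s) = (\<Sum>j\<in>A. E j * E j powr (s - 1))"
    using assms(2) split by (intro sum.cong) auto
  also have "\<dots> \<le> (\<Sum>j\<in>A. E j * T powr (s - 1))"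
    using assms(2,3) le by (intro sum_mono mult_left_mono powr_mono2) auto
  also have "\<dots> = (\<Sum>j\<in>A. E j) * T powr (s - 1)" by (simp add: sum_distrib_right)
  also have "\<dots> \<le> T * T powr (s - 1)" using assms(4) by (intro mult_right_mono) auto
  also have "\<dots> = T powr s" using split[OF T] by simp
  finally show ?thesis .
qed

text \<open>For finite \<open>p\<close> the integral over a piece is at most \<open>h * C powr p * E j powr (p / 2)\<close>, and
  \<open>sum_powr_le\<close> adds these up because \<open>p / 2 \<ge> 1\<close>.\<close>

lemma Lp_norm_piecewise_bound:
  fixes u :: "real \<Rightarrow> complex"
  assumes n: "2 \<le> n" and kn: "knots n \<rho>" and p: "2 \<le> p"
    and cont: "continuous_on {\<rho> 1..\<rho> n} u" and C: "0 \<le> C"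
    and E: "\<And>j. j \<in> {1..<n} \<Longrightarrow> 0 \<le> E j" and T: "(\<Sum>j\<in>{1..<n}. E j) \<le> T"
    and bound: "\<And>j r. j \<in> {1..<n} \<Longrightarrow> r \<in> {\<rho> j..\<rho> (Suc j)} \<Longrightarrow> norm (u r) \<le> C * sqrt (E j)"
  shows "Lp_norm p {\<rho> 1..\<rho> n} u \<le> ennreal (C * mesh n \<rho> powr enn2real (1 / p) * sqrt T)"
proof -
  let ?S = "{\<rho> 1..\<rho> n}"
  have meas: "u \<in> borel_measurable (lebesgue_on ?S)"
    by (rule continuous_imp_measurable_on_sets_lebesgue[OF cont]) simp
  have T0: "0 \<le> T" using sum_nonneg[of "{1..<n}" E] E T by fastforce
  have h: "0 < mesh n \<rho>"
    using mesh_ge[of 1 n \<rho>] knots_mono[OF kn, of 1 2] n by (auto simp: numeral_2_eq_2)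
  have ET: "E j \<le> T" if "j \<in> {1..<n}" for j
    using member_le_sum[of j "{1..<n}" E] E T that by fastforce
  show ?thesis
  proof (cases "p = \<infinity>")
    case True
    have "esssup (lebesgue_on ?S) (\<lambda>x. ennreal (norm (u x))) \<le> ennreal (C * sqrt T)"
    proof (rule esssup_I)
      show "(\<lambda>x. ennreal (norm (u x))) \<in> borel_measurable (lebesgue_on ?S)" using meas by measurable
      show "AE x in lebesgue_on ?S. ennreal (norm (u x)) \<le> ennreal (C * sqrt T)"
      proof (rule AE_I2)
        fix x assume "x \<in> space (lebesgue_on ?S)"
        then have "x \<in> ?S" by simp
        then obtain j where j: "j \<in> {1..<n}" "x \<in> {\<rho> j..\<rho> (Suc j)}" using knots_cover_closed[OF kn n] by blast
        have "norm (u x) \<le> C * sqrt (E j)" by (rule bound[OF j])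
        also have "\<dots> \<le> C * sqrt T" using ET[OF j(1)] C by (intro mult_left_mono) auto
        finally show "ennreal (norm (u x)) \<le> ennreal (C * sqrt T)" by (rule ennreal_leI)
      qed
    qed
    then show ?thesis using True h by (simp add: Lp_norm_def)
  next
    case False
    define P where "P = enn2real p"
    have pP: "p = ennreal P" using False by (simp add: P_def less_top)
    have P: "P \<ge> 2"
      using p unfolding pP by (metis P_def enn2real_nonneg ennreal_le_iff ennreal_numeral zero_le_numeral)
    have p1: "enn2real (1 / p) = 1 / P"
      unfolding pP using P by (simp add: divide_ennreal[of 1 P, simplified])
    define I where "I = (\<integral>\<^sup>+x. ennreal (norm (u x) powr P) \<partial>lebesgue_on ?S)"
    define V where "V = mesh n \<rho> * (C powr P * T powr (P / 2))"
    have V0: "0 \<le> V" using h by (simp add: V_def)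
    have "I \<le> (\<integral>\<^sup>+x. (\<Sum>j\<in>{1..<n}. ennreal ((C * sqrt (E j)) powr P) * indicator {\<rho> j..\<rho> (Suc j)} x) \<partial>lebesgue_on ?S)"
      unfolding I_def
    proof (rule nn_integral_mono)
      fix x assume "x \<in> space (lebesgue_on ?S)"
      then have "x \<in> ?S" by simp
      then obtain j where j: "j \<in> {1..<n}" "x \<in> {\<rho> j..\<rho> (Suc j)}" using knots_cover_closed[OF kn n] by blast
      have "ennreal (norm (u x) powr P) \<le> ennreal ((C * sqrt (E j)) powr P)"
        using bound[OF j] P by (intro ennreal_leI powr_mono2) auto
      also have "\<dots> = ennreal ((C * sqrt (E j)) powr P) * indicator {\<rho> j..\<rho> (Suc j)} x" using j by simp
      also have "\<dots> \<le> (\<Sum>j\<in>{1..<n}. ennreal ((C * sqrt (E j)) powr P) * indicator {\<rho> j..\<rho> (Suc j)} x)"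
        using j(1) by (intro member_le_sum[where f = "\<lambda>j. ennreal ((C * sqrt (E j)) powr P) * indicator {\<rho> j..\<rho> (Suc j)} x"]) auto
      finally show "ennreal (norm (u x) powr P) \<le> (\<Sum>j\<in>{1..<n}. ennreal ((C * sqrt (E j)) powr P) * indicator {\<rho> j..\<rho> (Suc j)} x)" .
    qed
    also have "\<dots> = (\<Sum>j\<in>{1..<n}. ennreal ((C * sqrt (E j)) powr P * (\<rho> (Suc j) - \<rho> j)))"
    proof -
      have "(\<integral>\<^sup>+x. ennreal ((C * sqrt (E j)) powr P) * indicator {\<rho> j..\<rho> (Suc j)} x \<partial>lebesgue_on ?S)
          = ennreal ((C * sqrt (E j)) powr P * (\<rho> (Suc j) - \<rho> j))"
        and "{\<rho> j..\<rho> (Suc j)} \<in> sets (lebesgue_on ?S)" if j: "j \<in> {1..<n}" for j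
      proof -
        have le: "\<rho> 1 \<le> \<rho> j" "\<rho> j \<le> \<rho> (Suc j)" "\<rho> (Suc j) \<le> \<rho> n"
          using j by (auto intro!: knots_mono_le[OF kn])
        have sub: "{\<rho> j..\<rho> (Suc j)} \<subseteq> ?S" using le by auto
        show set: "{\<rho> j..\<rho> (Suc j)} \<in> sets (lebesgue_on ?S)"
          using sub by (simp add: sets_restrict_space_iff)
        have "emeasure (lebesgue_on ?S) {\<rho> j..\<rho> (Suc j)} = ennreal (\<rho> (Suc j) - \<rho> j)"
          using sub le by (simp add: emeasure_restrict_space)
        then show "(\<integral>\<^sup>+x. ennreal ((C * sqrt (E j)) powr P) * indicator {\<rho> j..\<rho> (Suc j)} x \<partial>lebesgue_on ?S)
          = ennreal ((C * sqrt (E j)) powr P * (\<rho> (Suc j) - \<rho> j))"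
          using le unfolding nn_integral_cmult_indicator[OF set] by (simp add: ennreal_mult)
      qed
      then show ?thesis by (subst nn_integral_sum) auto
    qed
    also have "\<dots> = ennreal (\<Sum>j\<in>{1..<n}. (C * sqrt (E j)) powr P * (\<rho> (Suc j) - \<rho> j))"
      by (intro sum_ennreal mult_nonneg_nonneg) (auto intro!: knots_mono_le[OF kn])
    also have "\<dots> \<le> ennreal V"
    proof (rule ennreal_leI)
      have "(\<Sum>j\<in>{1..<n}. (C * sqrt (E j)) powr P * (\<rho> (Suc j) - \<rho> j))
          \<le> (\<Sum>j\<in>{1..<n}. (C powr P * E j powr (P / 2)) * mesh n \<rho>)"
      proof (rule sum_mono)
        fix j assume j: "j \<in> {1..<n}"
        have "(C * sqrt (E j)) powr P = C powr P * E j powr (P / 2)"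
          using C E[OF j] by (simp add: powr_mult powr_half_sqrt[symmetric] powr_powr)
        then show "(C * sqrt (E j)) powr P * (\<rho> (Suc j) - \<rho> j) \<le> (C powr P * E j powr (P / 2)) * mesh n \<rho>"
          using mesh_ge[OF j, of \<rho>] by (auto intro!: mult_left_mono)
      qed
      also have "\<dots> = mesh n \<rho> * (C powr P * (\<Sum>j\<in>{1..<n}. E j powr (P / 2)))"
        by (simp add: sum_distrib_left sum_distrib_right mult_ac)
      also have "\<dots> \<le> V"
        unfolding V_def using h P E T by (intro mult_left_mono sum_powr_le) auto
      finally show "(\<Sum>j\<in>{1..<n}. (C * sqrt (E j)) powr P * (\<rho> (Suc j) - \<rho> j)) \<le> V" .
    qed
    finally have IV: "I \<le> ennreal V" .
    then have Ifin: "I \<noteq> \<infinity>" by (auto simp: top_unique)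
    have "enn2real I powr (1 / P) \<le> V powr (1 / P)"
      using IV V0 P by (intro powr_mono2 enn2real_leI) auto
    also have "\<dots> = C * mesh n \<rho> powr (1 / P) * sqrt T"
      unfolding V_def using h C T0 P by (simp add: powr_mult powr_powr powr_half_sqrt)
    finally have "ennreal (enn2real I powr (1 / P)) \<le> ennreal (C * mesh n \<rho> powr (1 / P) * sqrt T)"
      by (rule ennreal_leI)
    then show ?thesis
      using False Ifin unfolding Lp_norm_def Let_def P_def[symmetric] I_def[symmetric] p1 by simp
  qed
qed

theorem corollary1:
  fixes n l :: nat and \<rho> :: "nat \<Rightarrow> real" and f \<sigma> :: "real \<Rightarrow> complex" and p :: ennreal
  assumes "n \<ge> 2" and "knots n \<rho>" and "f \<in> Lambda0"
    and "interpolant_A n \<rho> f \<sigma> \<or> interpolant_B n \<rho> f \<sigma>"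
    and "2 \<le> p" and "l \<in> {0, 1}"
  shows "Lp_norm p {\<rho> 1..\<rho> n} (\<lambda>r. nth_deriv l f r - nth_deriv l \<sigma> r)
    \<le> ennreal (1 / (2 ^ (1 - l) * sqrt (\<rho> 1))
        * mesh n \<rho> powr (3 / 2 + enn2real (1 / p) - real l) * norm0 f)"
proof -
  have n1: "1 \<le> n" using assms(1) by simp
  note en = interpolant_energy[OF n1 assms(2,3,4)]
  interpret smooth_competitor f \<sigma> by (rule en(1))
  define h where "h = mesh n \<rho>"
  define E where "E j = gap_energy f \<sigma> (\<rho> j) (\<rho> (Suc j))" for j
  have r1: "0 < \<rho> 1" using knots_pos[OF assms(2), of 1] n1 by simp
  have h0: "0 < h"
    using mesh_ge[of 1 n \<rho>] knots_mono[OF assms(2), of 1 2] assms(1) by (auto simp: numeral_2_eq_2 h_def)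
  have norm0: "0 \<le> norm0 f" by (rule Lambda0_energy(3)[OF assms(3)])
  have piece: "0 < \<rho> j" "\<rho> j < \<rho> (Suc j)" "\<rho> 1 \<le> \<rho> j" "\<rho> (Suc j) - \<rho> j \<le> h"
    "f (\<rho> j) - \<sigma> (\<rho> j) = 0" "f (\<rho> (Suc j)) - \<sigma> (\<rho> (Suc j)) = 0" "0 \<le> E j"
    "\<exists>c. flux_law \<sigma> c {\<rho> j<..<\<rho> (Suc j)}" if j: "j \<in> {1..<n}" for j
  proof -
    show pos: "0 < \<rho> j" "\<rho> j < \<rho> (Suc j)" "\<rho> 1 \<le> \<rho> j" "\<rho> (Suc j) - \<rho> j \<le> h"
      using j mesh_ge[OF j, of \<rho>] knots_pos[OF assms(2), of j] knots_mono[OF assms(2), of j "Suc j"]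
        knots_mono_le[OF assms(2), of 1 j] by (auto simp: h_def)
    show "f (\<rho> j) - \<sigma> (\<rho> j) = 0" "f (\<rho> (Suc j)) - \<sigma> (\<rho> (Suc j)) = 0"
      using en(2)[of j] en(2)[of "Suc j"] j by auto
    show flux: "\<exists>c. flux_law \<sigma> c {\<rho> j<..<\<rho> (Suc j)}" using en(3)[of j] j by auto
    then show "0 \<le> E j" unfolding E_def using gap_energy_nonneg[OF pos(1,2)] by blast
  qed
  have g1_bound: "norm (g1 r) \<le> sqrt h / sqrt (\<rho> 1) * sqrt (E j)"
    if j: "j \<in> {1..<n}" and r: "r \<in> {\<rho> j..\<rho> (Suc j)}" for j r
  proof -
    obtain c where c: "flux_law \<sigma> c {\<rho> j<..<\<rho> (Suc j)}" using piece(8)[OF j] by blast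
    have "(norm (g1 r))\<^sup>2 \<le> (\<rho> (Suc j) - \<rho> j) / \<rho> j * E j"
      unfolding E_def by (rule deriv_bound[OF piece(1,2)[OF j] c piece(5,6)[OF j] r])
    also have "\<dots> \<le> h / \<rho> 1 * E j"
      using piece[OF j] r1 h0 by (intro mult_right_mono frac_le) auto
    finally have "norm (g1 r) \<le> sqrt (h / \<rho> 1 * E j)" by (rule real_le_rsqrt)
    then show ?thesis by (simp add: real_sqrt_mult real_sqrt_divide)
  qed
  have g_bound: "norm (g r) \<le> h / 2 * (sqrt h / sqrt (\<rho> 1)) * sqrt (E j)"
    if j: "j \<in> {1..<n}" and r: "r \<in> {\<rho> j..\<rho> (Suc j)}" for j r
  proof -
    have "norm (g r) \<le> (\<rho> (Suc j) - \<rho> j) / 2 * (sqrt h / sqrt (\<rho> 1) * sqrt (E j))"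
      by (rule value_bound[OF piece(1,2)[OF j] piece(5,6)[OF j] g1_bound[OF j] r])
    also have "\<dots> \<le> h / 2 * (sqrt h / sqrt (\<rho> 1) * sqrt (E j))"
      using piece[OF j] r1 h0 by (intro mult_right_mono) auto
    finally show ?thesis by (simp add: mult.assoc)
  qed
  have T: "(\<Sum>j\<in>{1..<n}. E j) \<le> (norm0 f)\<^sup>2" using en(4) by (simp add: E_def)
  have sub: "{\<rho> 1..\<rho> n} \<subseteq> {0<..}" using r1 by auto
  note Lp = Lp_norm_piecewise_bound[OF assms(1,2,5) _ _ piece(7) T, folded h_def]
  show ?thesis
  proof (cases "l = 0")
    case True
    have "Lp_norm p {\<rho> 1..\<rho> n} g \<le> ennreal (h / 2 * (sqrt h / sqrt (\<rho> 1)) * h powr enn2real (1 / p) * sqrt ((norm0 f)\<^sup>2))"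
      by (rule Lp[OF continuous_on_subset[OF g_cont sub] _ _ g_bound]) (use h0 r1 in auto)
    also have "h / 2 * (sqrt h / sqrt (\<rho> 1)) * h powr enn2real (1 / p) * sqrt ((norm0 f)\<^sup>2)
        = 1 / (2 ^ (1 - l) * sqrt (\<rho> 1)) * h powr (3 / 2 + enn2real (1 / p) - real l) * norm0 f"
    proof -
      have "h powr (3 / 2 + enn2real (1 / p)) = h powr 1 * h powr (1 / 2) * h powr enn2real (1 / p)"
        unfolding powr_add[symmetric] by simp
      then show ?thesis using True h0 norm0 by (simp add: powr_half_sqrt)
    qed
    finally show ?thesis using True by (simp add: nth_deriv_simps(1) h_def)
  next
    case False
    then have l: "l = 1" using assms(6) by simp
    have "Lp_norm p {\<rho> 1..\<rho> n} g1 \<le> ennreal (sqrt h / sqrt (\<rho> 1) * h powr enn2real (1 / p) * sqrt ((norm0 f)\<^sup>2))"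
      by (rule Lp[OF continuous_on_subset[OF g1_cont sub] _ _ g1_bound]) (use h0 r1 in auto)
    also have "sqrt h / sqrt (\<rho> 1) * h powr enn2real (1 / p) * sqrt ((norm0 f)\<^sup>2)
        = 1 / (2 ^ (1 - l) * sqrt (\<rho> 1)) * h powr (3 / 2 + enn2real (1 / p) - real l) * norm0 f"
    proof -
      have "h powr (1 / 2 + enn2real (1 / p)) = h powr (1 / 2) * h powr enn2real (1 / p)"
        by (rule powr_add)
      then show ?thesis using l h0 norm0 by (simp add: powr_half_sqrt)
    qed
    finally show ?thesis by (simp only: l h_def)
  qed
qed

end
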